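(* Let $G$ be an infinite pseudocompact topological group. Then the topology of $G$ is initial with respect to the family of quotient homomorphisms of $G$ onto infinite compact metrizable groups. In particular, $G$ has a quotient group which is infinite, separable, compact and metrizable.
   Context: All topological groups are assumed to be Hausdorff. A topological group is pseudocompact if every continuous real-valued function on it is bounded. A quotient homomorphism is an open continuous surjective homomorphism; a quotient group of $G$ means $G/N$ with the quotient topology, $N$ a closed normal subgroup (the case $N=\{e\}$ is allowed). The topology of $G$ is initial with respect to a family of maps $f_i\colon G\to K_i$ if it is the coarsest topology on $G$ making all $f_i$ continuous, i.e. the sets $f_i^{-1}(V)$ with $V$ open in $K_i$ form a subbase of $G$. *)

theory Defs
  imports "HOL-Analysis.Analysis" "HOL-Algebra.Coset"
begin

text \<open>Topological groups are Hausdorff by convention.\<close>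

locale topological_group = group G for G (structure) +
  fixes T
  assumes topspace_eq_carrier: "topspace T = carrier G"
    and continuous_mult: "continuous_map (prod_topology T T) T (\<lambda>(x, y). x \<otimes> y)"
    and continuous_inv: "continuous_map T T (\<lambda>x. inv x)"
    and Hausdorff: "Hausdorff_space T"

definition pseudocompact_space :: "'a topology \<Rightarrow> bool" where
  "pseudocompact_space X \<longleftrightarrow>
     (\<forall>f. continuous_map X euclideanreal f \<longrightarrow> bounded (f ` topspace X))"

definition quotient_homomorphism ::
  "('a, 'm) monoid_scheme \<Rightarrow> 'a topology \<Rightarrow> ('b, 'n) monoid_scheme \<Rightarrow> 'b topology \<Rightarrow> ('a \<Rightarrow> 'b) \<Rightarrow> bool"
where
  "quotient_homomorphism G T K S f \<longleftrightarrow>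
     f \<in> hom G K \<and> f ` carrier G = carrier K \<and> continuous_map T S f \<and> open_map T S f"

text \<open>The topology of \<open>X\<close> is initial with respect to the family \<open>F\<close> of maps \<open>f\<close> into spaces \<open>S\<close>,
  given as pairs \<open>(S, f)\<close>.\<close>

definition initial_wrt :: "'a topology \<Rightarrow> ('b topology \<times> ('a \<Rightarrow> 'b)) set \<Rightarrow> bool" where
  "initial_wrt X F \<longleftrightarrow>
     (\<forall>(S, f) \<in> F. continuous_map X S f) \<and>
     (\<forall>Y. topspace Y = topspace X \<and> (\<forall>(S, f) \<in> F. continuous_map Y S f) \<longrightarrow>
          (\<forall>U. openin X U \<longrightarrow> openin Y U))"

text \<open>The whole space is added to the subbase because
  \<^const>\<open>topology_generated_by\<close> does not count the empty intersection.\<close>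

lemma initial_wrt_iff_subbase:
  assumes F: "\<And>S f. (S, f) \<in> F \<Longrightarrow> f \<in> topspace X \<rightarrow> topspace S"
  shows "initial_wrt X F \<longleftrightarrow>
    X = topology_generated_by
          (insert (topspace X) {{x \<in> topspace X. f x \<in> V} | S f V. (S, f) \<in> F \<and> openin S V})"
    (is "_ \<longleftrightarrow> X = topology_generated_by ?B")
proof -
  let ?I = "topology_generated_by ?B"
  have top: "topspace ?I = topspace X"
    unfolding topology_generated_by_topspace by auto
  have cont: "continuous_map ?I S f" if "(S, f) \<in> F" for S f
    unfolding continuous_map_def top
  proof (intro conjI allI impI)
    show "f \<in> topspace X \<rightarrow> topspace S" using F that .
    show "openin ?I {x \<in> topspace X. f x \<in> V}" if "openin S V" for V
      by (rule topology_generated_by_Basis) (use \<open>(S, f) \<in> F\<close> that in blast)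
  qed
  have least: "openin Y U"
    if Y: "topspace Y = topspace X" "\<forall>(S, f) \<in> F. continuous_map Y S f" and U: "openin ?I U" for Y U
  proof -
    have B: "openin Y W" if "W \<in> ?B" for W
      using that
    proof (elim insertE CollectE exE conjE)
      show "openin Y W" if "W = topspace X" using that Y(1) by (metis openin_topspace)
    next
      fix S f V assume "W = {x \<in> topspace X. f x \<in> V}" "(S, f) \<in> F" "openin S V"
      then show "openin Y W"
        using Y openin_continuous_map_preimage by fastforce
    qed
    have "generate_topology_on ?B U"
      using U by (simp only: openin_topology_generated_by_iff)
    then show ?thesis
      by (induction rule: generate_topology_on.induct) (use B in auto)
  qed
  show ?thesis
  proof
    assume X: "initial_wrt X F"
    show "X = ?I"
      unfolding topology_eq
    proof (intro allI iffI)
      fix U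
      show "openin ?I U" if "openin X U"
        using X that top cont unfolding initial_wrt_def by blast
      show "openin X U" if "openin ?I U"
        using X that least[of X U] unfolding initial_wrt_def by blast
    qed
  next
    assume X: "X = ?I"
    show "initial_wrt X F"
      unfolding initial_wrt_def
    proof (intro conjI allI impI)
      show "\<forall>(S, f) \<in> F. continuous_map X S f"
        using cont X by auto
    next
      fix Y U
      assume "topspace Y = topspace X \<and> (\<forall>(S, f) \<in> F. continuous_map Y S f)" "openin X U"
      then show "openin Y U"
        using X least[of Y U] by simp
    qed
  qed
qed

text \<open>The topology of \<open>G Mod N\<close>.\<close>

definition quotient_group_topology ::
  "('a, 'm) monoid_scheme \<Rightarrow> 'a topology \<Rightarrow> 'a set \<Rightarrow> 'a set topology" where
  "quotient_group_topology G T N =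
     topology (\<lambda>W. W \<subseteq> carrier (G Mod N) \<and> openin T {x \<in> carrier G. N #>\<^bsub>G\<^esub> x \<in> W})"

lemma (in topological_group) openin_quotient_group_topology:
  "openin (quotient_group_topology G T N) W \<longleftrightarrow>
     W \<subseteq> carrier (G Mod N) \<and> openin T {x \<in> carrier G. N #> x \<in> W}"
proof -
  have "istopology (\<lambda>W. W \<subseteq> carrier (G Mod N) \<and> openin T {x \<in> carrier G. N #> x \<in> W})"
    unfolding istopology_def
  proof (intro conjI allI impI)
    fix V W
    assume "V \<subseteq> carrier (G Mod N) \<and> openin T {x \<in> carrier G. N #> x \<in> V}"
      and "W \<subseteq> carrier (G Mod N) \<and> openin T {x \<in> carrier G. N #> x \<in> W}"
    moreover have "{x \<in> carrier G. N #> x \<in> V \<inter> W} =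
        {x \<in> carrier G. N #> x \<in> V} \<inter> {x \<in> carrier G. N #> x \<in> W}" by auto
    ultimately show "V \<inter> W \<subseteq> carrier (G Mod N)" "openin T {x \<in> carrier G. N #> x \<in> V \<inter> W}"
      by auto
  next
    fix \<W>
    assume *: "\<forall>W\<in>\<W>. W \<subseteq> carrier (G Mod N) \<and> openin T {x \<in> carrier G. N #> x \<in> W}"
    then show "\<Union>\<W> \<subseteq> carrier (G Mod N)" by blast
    have "{x \<in> carrier G. N #> x \<in> \<Union>\<W>} = (\<Union>W\<in>\<W>. {x \<in> carrier G. N #> x \<in> W})" by auto
    then show "openin T {x \<in> carrier G. N #> x \<in> \<Union>\<W>}" using * by auto
  qed
  then show ?thesis
    by (simp add: quotient_group_topology_def)
qed

lemma (in topological_group) quotient_map_quotient_group_topology: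
  "quotient_map T (quotient_group_topology G T N) (\<lambda>x. N #> x)"
proof -
  have "{x \<in> carrier G. N #> x \<in> carrier (G Mod N)} = topspace T"
    by (auto simp: carrier_FactGroup topspace_eq_carrier)
  then have "openin (quotient_group_topology G T N) (carrier (G Mod N))"
    by (simp add: openin_quotient_group_topology)
  then have "topspace (quotient_group_topology G T N) = carrier (G Mod N)"
    by (meson openin_quotient_group_topology openin_subset openin_topspace subset_antisym)
  then show ?thesis
    by (auto simp: quotient_map_def openin_quotient_group_topology topspace_eq_carrier
        carrier_FactGroup)
qed

text \<open>The target groups live on the type \<^typ>\<open>'a set\<close>. Up to topological isomorphism this is no
  restriction: a quotient homomorphism \<open>f\<close> of \<open>G\<close> onto \<open>K\<close>, over whatever type, identifies \<open>K\<close>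
  with a group of cosets of the kernel of \<open>f\<close>.\<close>

definition infinite_compact_metrizable_quotients ::
  "('a, 'm) monoid_scheme \<Rightarrow> 'a topology \<Rightarrow> ('a set topology \<times> ('a \<Rightarrow> 'a set)) set" where
  "infinite_compact_metrizable_quotients G T =
     {(S, f). \<exists>K :: 'a set monoid.
        topological_group K S \<and> infinite (carrier K) \<and> compact_space S \<and> metrizable_space S \<and>
        quotient_homomorphism G T K S f}"

end

theory Submission
  imports Defs
begin

text \<open>A pseudocompact group is precompact and, being completely regular, has no locally finite
  sequence of nonempty open sets. By precompactness the conjugation-invariant neighbourhoods form a
  base at the identity. Choose such symmetric neighbourhoods with \<open>V (n + 1)\<^sup>3 \<subseteq> V n\<close> inside a given
  neighbourhood. Their intersection \<open>N\<close> is a closed normal subgroup, and the images of the \<open>V n\<close>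
  form a base at the identity of \<open>G/N\<close>: otherwise points \<open>x n \<in> V n\<close> outside a saturated
  neighbourhood of \<open>N\<close> would give a locally finite sequence of open sets. So \<open>G/N\<close> is metrizable by
  Birkhoff and Kakutani, and pseudocompactness makes it compact. If the \<open>V n\<close> also avoid the quotients
  \<open>g i (g j)\<inverse>\<close> of an injective sequence \<open>g\<close>, then \<open>G/N\<close> is infinite.\<close>

subsection \<open>Pseudocompact and metrizable spaces\<close>

text \<open>Without such a point the sets \<open>A n\<close> would be locally finite. A sum of bump
  functions, the n-th one vanishing off \<open>A n\<close> and reaching height n, would then be
  continuous and unbounded.\<close>

lemma completely_regular_pseudocompact_cluster_point:
  fixes A :: "nat \<Rightarrow> 'a set"
  assumes X: "completely_regular_space X" "pseudocompact_space X"
    and A: "\<And>n. openin X (A n)" "\<And>n. A n \<noteq> {}"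
  obtains x where "x \<in> topspace X"
    and "\<And>W. \<lbrakk>openin X W; x \<in> W\<rbrakk> \<Longrightarrow> infinite {n. A n \<inter> W \<noteq> {}}"
proof (rule ccontr)
  assume "\<not> thesis"
  then have "\<forall>x\<in>topspace X. \<exists>W. openin X W \<and> x \<in> W \<and> finite {n. A n \<inter> W \<noteq> {}}"
    using that by blast
  from bchoice[OF this] obtain W where W: "\<And>x. x \<in> topspace X \<Longrightarrow> openin X (W x)" "\<And>x. x \<in> topspace X \<Longrightarrow> x \<in> W x"
      "\<And>x. x \<in> topspace X \<Longrightarrow> finite {n. A n \<inter> W x \<noteq> {}}"
    by blast
  obtain p where p: "\<And>n. p n \<in> A n" using choice[of "\<lambda>n x. x \<in> A n"] A(2) by blast
  have "\<exists>g::'a\<Rightarrow>real. continuous_map X euclideanreal g \<and> (\<forall>x\<in>topspace X. 0 \<le> g x) \<and> g (p n) = 1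
        \<and> (\<forall>x\<in>topspace X - A n. g x = 0)" for n
  proof -
    have "closedin X (topspace X - A n)" "p n \<in> topspace X - (topspace X - A n)"
      using A(1)[of n] p[of n] openin_subset by blast+
    then obtain f :: "'a\<Rightarrow>real" where f: "continuous_map X (top_of_set {0..1}) f"
       "f (p n) = 0" "f ` (topspace X - A n) \<subseteq> {1}"
      using X(1) unfolding completely_regular_space_def by meson
    have "continuous_map X euclideanreal f" "\<And>x. x \<in> topspace X \<Longrightarrow> f x \<le> 1"
      using f(1) by (auto simp: continuous_map_in_subtopology)
    \<comment> \<open>Complete regularity yields value 0 at \<open>p n\<close> and 1 off
      \<open>A n\<close>; \<open>1 - f\<close> turns this into a bump.\<close>
    then show ?thesis
      using f by (intro exI[of _ "\<lambda>x. 1 - f x"]) (auto intro!: continuous_intros)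
  qed
  then have "\<exists>g. \<forall>n. continuous_map X euclideanreal (g n) \<and> (\<forall>x\<in>topspace X. 0 \<le> g n x) \<and>
      g n (p n) = 1 \<and> (\<forall>x\<in>topspace X - A n. g n x = 0)"
    by (intro choice allI)
  then obtain g :: "nat \<Rightarrow> 'a \<Rightarrow> real" where g: "\<And>n. continuous_map X euclideanreal (g n)"
     "\<And>n x. x \<in> topspace X \<Longrightarrow> 0 \<le> g n x" "\<And>n. g n (p n) = 1"
     "\<And>n x. x \<in> topspace X \<Longrightarrow> x \<notin> A n \<Longrightarrow> g n x = 0"
    by auto
  \<comment> \<open>The factor \<open>n\<close> forces \<open>F (p n)\<close> to be at least
    \<open>n\<close>.\<close>
  define F where "F x = (\<Sum>n\<in>{n. x \<in> A n}. real n * g n x)" for x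
  have fin: "finite {n. x \<in> A n}" if "x \<in> topspace X" for x
    by (rule finite_subset[OF _ W(3)[OF that]]) (use W(2)[OF that] in blast)
  \<comment> \<open>On \<open>W x\<close> one finite index set serves all points, so
    \<open>F\<close> agrees there with a finite sum of continuous functions.\<close>
  have F_local: "F y = (\<Sum>n\<in>{n. A n \<inter> W x \<noteq> {}}. real n * g n y)"
    if "x \<in> topspace X" "y \<in> W x" for x y
  proof -
    have "y \<in> topspace X" using W(1)[OF that(1)] openin_subset that by blast
    then show ?thesis
      unfolding F_def by (intro sum.mono_neutral_left) (use W(3) that g(4) in auto)
  qed
  have "continuous_map X euclideanreal F"
    unfolding continuous_map_def
  proof (intro conjI allI impI)
    fix U :: "real set" assume U: "openin euclideanreal U"
    show "openin X {x \<in> topspace X. F x \<in> U}"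
    proof (subst openin_subopen, safe)
      fix x assume x: "x \<in> topspace X" "F x \<in> U"
      let ?F = "\<lambda>y. \<Sum>n\<in>{n. A n \<inter> W x \<noteq> {}}. real n * g n y"
      have "continuous_map X euclideanreal ?F"
        using W(3)[OF x(1)] g(1) by (intro continuous_intros) auto
      then have "openin X {y \<in> topspace X. ?F y \<in> U}"
        using U openin_continuous_map_preimage by blast
      then have "openin X (W x \<inter> {y \<in> topspace X. ?F y \<in> U})"
        using W(1)[OF x(1)] by blast
      moreover have "x \<in> W x \<inter> {y \<in> topspace X. ?F y \<in> U}"
        using W(2)[OF x(1)] x F_local[OF x(1)] by auto
      moreover have "W x \<inter> {y \<in> topspace X. ?F y \<in> U} \<subseteq> {x \<in> topspace X. F x \<in> U}"
        using F_local[OF x(1)] by auto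
      ultimately show "\<exists>T. openin X T \<and> x \<in> T \<and> T \<subseteq> {x \<in> topspace X. F x \<in> U}"
        by blast
    qed
  qed auto
  then have "bounded (F ` topspace X)"
    using X(2) by (simp add: pseudocompact_space_def)
  then obtain B where B: "\<And>x. x \<in> topspace X \<Longrightarrow> \<bar>F x\<bar> \<le> B"
    by (auto simp: bounded_iff)
  obtain n :: nat where n: "B < real n" using reals_Archimedean2 by blast
  have pn: "p n \<in> topspace X" using p A(1) openin_subset by blast
  have "real n * g n (p n) \<le> F (p n)"
    unfolding F_def using fin[OF pn] p g(2)[OF pn]
    by (intro member_le_sum) auto
  then show False using g(3)[of n] B[OF pn] n by simp
qed

text \<open>A sequence is thickened to balls of radius \<open>1/(n+1)\<close>. A cluster point of
  these open sets is the limit of a subsequence, which gives sequential compactness.\<close>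

lemma pseudocompact_metrizable_imp_compact_space:
  assumes "metrizable_space X" "pseudocompact_space X"
  shows "compact_space X"
proof -
  obtain M d where M: "Metric_space M d" and X: "X = Metric_space.mtopology M d"
    using assms(1) by (auto simp: metrizable_space_def)
  interpret Metric_space M d by fact
  show ?thesis
    unfolding X compact_space_sequentially
  proof (intro allI impI)
    fix \<sigma> :: "nat \<Rightarrow> 'a" assume \<sigma>: "range \<sigma> \<subseteq> M"
    obtain x where x: "x \<in> M"
      and inf: "\<And>W. \<lbrakk>openin X W; x \<in> W\<rbrakk> \<Longrightarrow> infinite {n. mball (\<sigma> n) (inverse (Suc n)) \<inter> W \<noteq> {}}"
    proof (rule completely_regular_pseudocompact_cluster_point
              [of X "\<lambda>n. mball (\<sigma> n) (inverse (Suc n))"])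
      show "mball (\<sigma> n) (inverse (Suc n)) \<noteq> {}" for n
      proof -
        have "\<sigma> n \<in> mball (\<sigma> n) (inverse (Suc n))"
          using \<sigma> by (subst centre_in_mball_iff) auto
        then show ?thesis by blast
      qed
    qed (use assms metrizable_imp_completely_regular_space X in auto)
    \<comment> \<open>For \<open>m > k\<close> the ball around \<open>\<sigma> m\<close> has radius
      below \<open>e/2\<close>; when it meets the ball of radius \<open>e/2\<close> around
      \<open>x\<close>, the centres are closer than \<open>e\<close>.\<close>
    have "\<exists>m>n. d (\<sigma> m) x < e" if e: "e > 0" for n e
    proof -
      obtain k where k: "inverse (real (Suc k)) < e/2"
        using reals_Archimedean[OF half_gt_zero[OF e]] by blast
      have "infinite {n. mball (\<sigma> n) (inverse (Suc n)) \<inter> mball x (e/2) \<noteq> {}}"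
        using inf[of "mball x (e/2)"] X x e by simp
      then obtain m where m: "m > max n k" "mball (\<sigma> m) (inverse (Suc m)) \<inter> mball x (e/2) \<noteq> {}"
        unfolding infinite_nat_iff_unbounded by blast
      then obtain y where y: "y \<in> M" "d (\<sigma> m) y < inverse (Suc m)" "d x y < e/2"
        by auto
      have "inverse (real (Suc m)) \<le> inverse (real (Suc k))"
        using m(1) by (intro le_imp_inverse_le) auto
      moreover have "d (\<sigma> m) x \<le> d (\<sigma> m) y + d x y"
        using triangle[of "\<sigma> m" y x] commute[of x y] y(1) x range_subsetD[OF \<sigma>] by simp
      ultimately show ?thesis using m(1) y(3) k y(2) by (intro exI[of _ m] conjI) linarith+
    qed
    then have step: "\<exists>m. m > n \<and> d (\<sigma> m) x < inverse (Suc k)" for n k :: nat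
      by simp
    have "\<exists>r. \<forall>k. d (\<sigma> (r k)) x < inverse (Suc k) \<and> r k < r (Suc k)"
      using step by (intro dependent_nat_choice) blast+
    then obtain r where r: "\<And>k. d (\<sigma> (r k)) x < inverse (Suc k)" "\<And>k. r k < r (Suc k)"
      by blast
    have "(\<lambda>k. d (\<sigma> (r k)) x) \<longlonglongrightarrow> 0"
      by (rule real_tendsto_sandwich[OF _ _ tendsto_const LIMSEQ_inverse_real_of_nat])
         (use r(1) in \<open>auto intro!: always_eventually less_imp_le\<close>)
    then have "limitin mtopology (\<sigma> \<circ> r) x sequentially"
      using x range_subsetD[OF \<sigma>] by (auto simp: limitin_metric_dist_null)
    then show "\<exists>l r. l \<in> M \<and> strict_mono r \<and> limitin mtopology (\<sigma> \<circ> r) l sequentially"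
      using x r(2) strict_mono_Suc_iff by blast
  qed
qed

lemma pseudocompact_space_continuous_map_image:
  assumes "pseudocompact_space X" "continuous_map X Y f" "f ` topspace X = topspace Y"
  shows "pseudocompact_space Y"
  unfolding pseudocompact_space_def
proof (intro allI impI)
  fix g :: "'b \<Rightarrow> real" assume "continuous_map Y euclideanreal g"
  then have "bounded ((g \<circ> f) ` topspace X)"
    using assms(1) continuous_map_compose[OF assms(2)] unfolding pseudocompact_space_def by blast
  then show "bounded (g ` topspace Y)"
    using assms(3) by (metis image_comp)
qed

text \<open>Total boundedness gives a finite net for every radius \<open>1/(n+1)\<close>; the union
  of these nets is countable and dense.\<close>

lemma compact_metrizable_imp_separable_space:
  assumes "compact_space X" "metrizable_space X"
  shows "separable_space X"
proof -
  obtain M d where M: "Metric_space M d" and X: "X = Metric_space.mtopology M d"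
    using assms(2) by (auto simp: metrizable_space_def)
  interpret Metric_space M d by fact
  have "mtotally_bounded M"
    using assms(1) unfolding X compact_space_eq_mcomplete_mtotally_bounded by blast
  then have "\<forall>n::nat. \<exists>K. finite K \<and> K \<subseteq> M \<and> M \<subseteq> (\<Union>x\<in>K. mball x (inverse (Suc n)))"
    unfolding mtotally_bounded_def by (simp del: of_nat_Suc)
  from choice[OF this] obtain K where K: "\<And>n::nat. finite (K n)" "\<And>n. K n \<subseteq> M"
    "\<And>n. M \<subseteq> (\<Union>x\<in>K n. mball x (inverse (Suc n)))"
    by blast
  have "mtopology closure_of (\<Union>n. K n) = M"
    unfolding metric_closure_of
  proof (intro equalityI subsetI CollectI conjI allI impI)
    fix x and r :: real assume x: "x \<in> M" and "0 < r"
    then obtain n where n: "inverse (real (Suc n)) < r" using reals_Archimedean by blast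
    obtain y where "y \<in> K n" "x \<in> mball y (inverse (Suc n))" using K(3) x by blast
    then show "\<exists>y\<in>(\<Union>n. K n). y \<in> mball x r"
      using n by (intro bexI[of _ y]) (auto simp: commute)
  qed auto
  then show ?thesis
    unfolding separable_space_def X topspace_mtopology
    using K(1,2) by (intro exI[of _ "\<Union>n. K n"]) (auto intro: countable_finite)
qed

subsection \<open>Seminorms on topological groups\<close>

text \<open>The induction stops at the first entry where the partial sums exceed \<open>c\<close>.
  With \<open>c\<close> half of the total, the blocks \<open>us\<close> and \<open>vs\<close> each
  carry at most half, which drives the later induction on words.\<close>

lemma split_at_partial_sum:
  fixes g :: "'a \<Rightarrow> real"
  assumes "0 \<le> c" "c < (\<Sum>x\<leftarrow>xs. g x)"
  obtains us k vs where "xs = us @ k # vs" "(\<Sum>x\<leftarrow>us. g x) \<le> c" "c < (\<Sum>x\<leftarrow>us. g x) + g k"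
  using assms
proof (induction xs arbitrary: c thesis)
  case Nil
  then show ?case by simp
next
  case (Cons x xs)
  show ?case
  proof (cases "c < g x")
    case True
    then show ?thesis using Cons.prems(1)[of "[]" x xs] Cons.prems(2) by simp
  next
    case False
    then obtain us k vs where "xs = us @ k # vs" "(\<Sum>x\<leftarrow>us. g x) \<le> c - g x" "c - g x < (\<Sum>x\<leftarrow>us. g x) + g k"
      using Cons.IH[of "c - g x"] Cons.prems by auto
    then show ?thesis using Cons.prems(1)[of "x # us" k vs] by simp
  qed
qed

context topological_group
begin

lemma openin_subset_carrier: "openin T U \<Longrightarrow> U \<subseteq> carrier G"
  using openin_subset topspace_eq_carrier by metis

lemma continuous_map_mult:
  assumes "continuous_map X T f" "continuous_map X T g"
  shows "continuous_map X T (\<lambda>x. f x \<otimes> g x)"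
  using continuous_map_compose[OF continuous_map_pairedI[OF assms] continuous_mult]
  by (simp add: o_def)

lemma continuous_map_inv:
  assumes "continuous_map X T f"
  shows "continuous_map X T (\<lambda>x. inv f x)"
  using continuous_map_compose[OF assms continuous_inv] by (simp add: o_def)

lemma continuous_map_translate:
  assumes "a \<in> carrier G" "b \<in> carrier G"
  shows "continuous_map T T (\<lambda>x. a \<otimes> x \<otimes> b)"
  using assms by (intro continuous_map_mult) (auto simp: topspace_eq_carrier)

lemma openin_translate_preimage:
  assumes "openin T U" "a \<in> carrier G" "b \<in> carrier G"
  shows "openin T {x \<in> carrier G. a \<otimes> x \<otimes> b \<in> U}"
  using openin_continuous_map_preimage[OF continuous_map_translate] assms topspace_eq_carrier
  by metis

lemma openin_left_preimage:
  assumes "openin T U" "a \<in> carrier G"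
  shows "openin T {x \<in> carrier G. a \<otimes> x \<in> U}"
proof -
  have "{x \<in> carrier G. a \<otimes> x \<in> U} = {x \<in> carrier G. a \<otimes> x \<otimes> \<one> \<in> U}"
    using assms by auto
  then show ?thesis using openin_translate_preimage assms by simp
qed

lemma openin_right_preimage:
  assumes "openin T U" "a \<in> carrier G"
  shows "openin T {x \<in> carrier G. x \<otimes> a \<in> U}"
proof -
  have "{x \<in> carrier G. x \<otimes> a \<in> U} = {x \<in> carrier G. \<one> \<otimes> x \<otimes> a \<in> U}"
    using assms by auto
  then show ?thesis using openin_translate_preimage assms by simp
qed

lemma openin_inv_preimage:
  assumes "openin T U"
  shows "openin T {x \<in> carrier G. inv x \<in> U}"
  using openin_continuous_map_preimage[OF continuous_inv assms] by (simp add: topspace_eq_carrier)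

section \<open>Symmetric neighbourhoods and cube sequences\<close>

definition symmetric_nhd :: "'a set \<Rightarrow> bool" where
  "symmetric_nhd V \<longleftrightarrow> openin T V \<and> \<one> \<in> V \<and> (\<forall>x\<in>V. inv x \<in> V)"

text \<open>Continuity of multiplication at \<open>(\<one>, \<one>)\<close> gives a box
  \<open>A \<times> B\<close> mapped into \<open>U\<close>; \<open>A \<inter> B\<close> serves for
  both factors.\<close>

lemma square_nhd_exists:
  assumes "openin T U" "\<one> \<in> U"
  obtains V where "openin T V" "\<one> \<in> V" "\<And>x y. \<lbrakk>x \<in> V; y \<in> V\<rbrakk> \<Longrightarrow> x \<otimes> y \<in> U"
proof -
  let ?P = "{p \<in> topspace (prod_topology T T). (\<lambda>(x, y). x \<otimes> y) p \<in> U}"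
  have "openin (prod_topology T T) ?P"
    using openin_continuous_map_preimage[OF continuous_mult assms(1)] .
  moreover have "(\<one>, \<one>) \<in> ?P"
    using assms(2) by (simp add: topspace_eq_carrier)
  ultimately obtain A B where AB: "openin T A" "openin T B" "\<one> \<in> A" "\<one> \<in> B" "A \<times> B \<subseteq> ?P"
    unfolding openin_prod_topology_alt by meson
  show ?thesis
    by (rule that[of "A \<inter> B"]) (use AB in auto)
qed

text \<open>Squaring is applied twice, from \<open>U\<close> to \<open>A\<close> and from
  \<open>A\<close> to \<open>B\<close>: for factors in \<open>B\<close> the product
  \<open>x \<otimes> y\<close> lies in \<open>A\<close>, and so does \<open>z\<close>. Intersecting
  \<open>B\<close> with its inverse gives symmetry.\<close>

lemma cube_nhd_exists:
  assumes "openin T U" "\<one> \<in> U"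
  obtains V where "symmetric_nhd V" "V \<subseteq> U"
    "\<And>x y z. \<lbrakk>x \<in> V; y \<in> V; z \<in> V\<rbrakk> \<Longrightarrow> x \<otimes> y \<otimes> z \<in> U"
proof -
  obtain A where A: "openin T A" "\<one> \<in> A" "\<And>x y. \<lbrakk>x \<in> A; y \<in> A\<rbrakk> \<Longrightarrow> x \<otimes> y \<in> U"
    using square_nhd_exists[OF assms] by metis
  obtain B where B: "openin T B" "\<one> \<in> B" "\<And>x y. \<lbrakk>x \<in> B; y \<in> B\<rbrakk> \<Longrightarrow> x \<otimes> y \<in> A"
    using square_nhd_exists[OF A(1,2)] by metis
  have BA: "B \<subseteq> A" "A \<subseteq> U"
    using B(3)[of _ \<one>] B(2) openin_subset_carrier[OF B(1)] A(3)[of _ \<one>] A(2) openin_subset_carrier[OF A(1)]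
    by force+
  let ?V = "B \<inter> {x \<in> carrier G. inv x \<in> B}"
  show ?thesis
  proof (rule that[of ?V])
    show "symmetric_nhd ?V"
      using B openin_inv_preimage[OF B(1)] by (auto simp: symmetric_nhd_def)
    show "?V \<subseteq> U" using BA by blast
    show "x \<otimes> y \<otimes> z \<in> U" if "x \<in> ?V" "y \<in> ?V" "z \<in> ?V" for x y z
      by (rule A(3)[OF B(3)]) (use that BA in auto)
  qed
qed

text \<open>Products of three factors are controlled because a word is later cut into a left block,
  one letter and a right block.\<close>

definition cube_sequence :: "(nat \<Rightarrow> 'a set) \<Rightarrow> bool" where
  "cube_sequence V \<longleftrightarrow> (\<forall>n. symmetric_nhd (V n)) \<and>
     (\<forall>n. \<forall>x\<in>V (Suc n). \<forall>y\<in>V (Suc n). \<forall>z\<in>V (Suc n). x \<otimes> y \<otimes> z \<in> V n)"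

text \<open>By dependent choice each set is refined inside a cube root of its predecessor. The sets
  \<open>B n\<close> prescribe the size; \<open>P\<close> is trivial for metrization and conjugation
  invariance for the construction of normal kernels.\<close>

lemma cube_sequence_exists:
  assumes refine: "\<And>U. \<lbrakk>openin T U; \<one> \<in> U\<rbrakk> \<Longrightarrow> \<exists>V. symmetric_nhd V \<and> P V \<and> V \<subseteq> U"
    and B: "\<And>n. openin T (B n)" "\<And>n. \<one> \<in> B n"
  obtains V where "cube_sequence V" "\<And>n. P (V n)" "\<And>n. V n \<subseteq> B n"
proof -
  have "\<exists>V. \<forall>n. (symmetric_nhd (V n) \<and> P (V n) \<and> V n \<subseteq> B n) \<and>
     (\<forall>x\<in>V (Suc n). \<forall>y\<in>V (Suc n). \<forall>z\<in>V (Suc n). x \<otimes> y \<otimes> z \<in> V n)"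
  proof (rule dependent_nat_choice)
    show "\<exists>V. symmetric_nhd V \<and> P V \<and> V \<subseteq> B 0"
      using refine B by blast
  next
    fix U n assume U: "symmetric_nhd U \<and> P U \<and> U \<subseteq> B n"
    then obtain W where W: "symmetric_nhd W" "W \<subseteq> U"
      "\<And>x y z. \<lbrakk>x \<in> W; y \<in> W; z \<in> W\<rbrakk> \<Longrightarrow> x \<otimes> y \<otimes> z \<in> U"
      using cube_nhd_exists[of U] symmetric_nhd_def by metis
    obtain V where "symmetric_nhd V" "P V" "V \<subseteq> W \<inter> B (Suc n)"
      using refine[of "W \<inter> B (Suc n)"] W(1) B by (auto simp: symmetric_nhd_def)
    then show "\<exists>V. (symmetric_nhd V \<and> P V \<and> V \<subseteq> B (Suc n)) \<and>
        (\<forall>x\<in>V. \<forall>y\<in>V. \<forall>z\<in>V. x \<otimes> y \<otimes> z \<in> U)"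
      using W(3) by blast
  qed
  then show ?thesis
    using that unfolding cube_sequence_def by blast
qed

section \<open>Words and the adapted seminorm\<close>

text \<open>The index list is kept so that a product can be weighed: the letter \<open>n\<close>
  counts \<open>(1/2)^n\<close>, and the seminorm of an element will be the infimum of the weights
  of the words whose product set contains it.\<close>

primrec word_set :: "(nat \<Rightarrow> 'a set) \<Rightarrow> nat list \<Rightarrow> 'a set" where
  "word_set V [] = {\<one>}"
| "word_set V (n # ns) = V n <#> word_set V ns"

lemma word_set_append:
  assumes "\<And>n. V n \<subseteq> carrier G"
  shows "word_set V ms \<subseteq> carrier G" "word_set V (ms @ ns) = word_set V ms <#> word_set V ns"
proof -
  show *: "word_set V ms \<subseteq> carrier G" for ms
    by (induction ms) (auto simp: assms set_mult_closed)
  show "word_set V (ms @ ns) = word_set V ms <#> word_set V ns"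
  proof (induction ms)
    case Nil
    have "{\<one>} <#> word_set V ns = word_set V ns"
      using *[of ns] by (force simp: set_mult_def)
    then show ?case by simp
  next
    case (Cons m ms)
    then show ?case using assms * by (simp add: set_mult_assoc)
  qed
qed

text \<open>Inversion reverses the factors. Reversal keeps the weight of a word, so the seminorm
  becomes invariant under inversion.\<close>

lemma word_set_inv:
  assumes V: "\<And>n. V n \<subseteq> carrier G" "\<And>n x. x \<in> V n \<Longrightarrow> inv x \<in> V n" and x: "x \<in> word_set V ns"
  shows "inv x \<in> word_set V (rev ns)"
  using x
proof (induction ns arbitrary: x)
  case Nil
  then show ?case by simp
next
  case (Cons n ns)
  then obtain v y where vy: "v \<in> V n" "y \<in> word_set V ns" "x = v \<otimes> y"
    by (auto simp: set_mult_def)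
  have "inv v \<in> word_set V [n]"
    using V vy(1) by (force simp: set_mult_def)
  moreover have "inv x = inv y \<otimes> inv v"
    using vy V(1) word_set_append(1)[of V ns] by (auto simp: inv_mult_group subset_iff)
  ultimately show ?case
    using Cons.IH[OF vy(2)] by (auto simp: word_set_append(2)[OF V(1)] set_mult_def simp del: word_set.simps)
qed

text \<open>The chain lemma of Birkhoff and Kakutani: cut a word at the letter where the partial sums of
  weights pass half of the total.\<close>

lemma word_set_subset:
  assumes V: "\<And>n. \<one> \<in> V n" "\<And>n. V n \<subseteq> carrier G"
    and cube: "\<And>n x y z. \<lbrakk>x \<in> V (Suc n); y \<in> V (Suc n); z \<in> V (Suc n)\<rbrakk> \<Longrightarrow> x \<otimes> y \<otimes> z \<in> V n"
    and "(\<Sum>n\<leftarrow>ns. (1/2)^n) < ((1/2::real)^m)"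
  shows "word_set V ns \<subseteq> V m"
  using assms(4)
proof (induction ns arbitrary: m rule: length_induct)
  case (1 ns)
  \<comment> \<open>An element is padded with two identity factors so that the cube condition
    applies.\<close>
  have anti: "V (Suc n) \<subseteq> V n" for n
    using cube[of \<one> n \<one>] V by fastforce
  then have anti: "V n \<subseteq> V m" if "m \<le> n" for m n
    using lift_Suc_antimono_le[of V] that by blast
  define g :: "nat \<Rightarrow> real" where "g n = (1/2)^n" for n
  show ?case
  proof (cases "ns = []")
    case True
    then show ?thesis using V by simp
  next
    case False
    have nonneg: "0 \<le> (\<Sum>n\<leftarrow>ns. g n)" for ns
      by (rule sum_list_nonneg) (auto simp: g_def)
    have pos: "0 < (\<Sum>n\<leftarrow>ns. g n)"
      using False nonneg[of "tl ns"] by (cases ns) (auto simp: g_def add_pos_nonneg)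
    \<comment> \<open>The cut at half of the total leaves \<open>us\<close> and \<open>vs\<close>
      with weight below \<open>g (Suc m)\<close>; both are shorter than \<open>ns\<close>, so the
      induction hypothesis places their products in \<open>V (Suc m)\<close>.\<close>
    obtain us k vs where ns: "ns = us @ k # vs" "(\<Sum>n\<leftarrow>us. g n) \<le> (\<Sum>n\<leftarrow>ns. g n)/2"
        "(\<Sum>n\<leftarrow>ns. g n)/2 < (\<Sum>n\<leftarrow>us. g n) + g k"
      using split_at_partial_sum[of "(\<Sum>n\<leftarrow>ns. g n)/2" g ns] pos by auto
    have m: "(\<Sum>n\<leftarrow>ns. g n) < g m" using 1(2) by (simp add: g_def)
    have half: "g (Suc m) = g m / 2" by (simp add: g_def)
    have us: "word_set V us \<subseteq> V (Suc m)" and vs: "word_set V vs \<subseteq> V (Suc m)"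
      using 1(1) ns m half unfolding g_def[symmetric] by auto
    have k: "V k \<subseteq> V (Suc m)"
    proof (rule anti)
      \<comment> \<open>A single letter weighs no more than the whole word, so its index must exceed
        \<open>m\<close>.\<close>
      have "g k < g m"
        using ns(1) m nonneg[of us] nonneg[of vs] by simp
      then show "Suc m \<le> k"
        using power_decreasing[of k m "1/2::real"] unfolding g_def by (cases "k \<le> m") auto
    qed
    have ns_eq: "word_set V ns = word_set V us <#> (V k <#> word_set V vs)"
      using ns(1) word_set_append(2)[OF V(2)] by simp
    have mult: "x \<otimes> (y \<otimes> z) \<in> V m" if "x \<in> V (Suc m)" "y \<in> V (Suc m)" "z \<in> V (Suc m)" for x y z
    proof -
      have "x \<in> carrier G" "y \<in> carrier G" "z \<in> carrier G"
        using that V(2) by blast+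
      then show ?thesis using cube[OF that] by (simp add: m_assoc)
    qed
    show ?thesis
    proof
      fix w assume "w \<in> word_set V ns"
      then obtain x y z where "w = x \<otimes> (y \<otimes> z)" "x \<in> word_set V us" "y \<in> V k" "z \<in> word_set V vs"
        unfolding ns_eq set_mult_def by blast
      then show "w \<in> V m"
        using mult[of x y z] us vs k by blast
    qed
  qed
qed

text \<open>The last two clauses make the balls of \<open>f\<close> and the sets \<open>V n\<close>
  equivalent at the identity. The exponent \<open>Suc n\<close> leaves weight 1, that of the letter
  0, free for the whole group in the construction.\<close>

definition adapted_seminorm :: "(nat \<Rightarrow> 'a set) \<Rightarrow> ('a \<Rightarrow> real) \<Rightarrow> bool" where
  "adapted_seminorm V f \<longleftrightarrow> f \<one> = 0 \<and> (\<forall>x\<in>carrier G. 0 \<le> f x) \<and> (\<forall>x\<in>carrier G. f (inv x) = f x) \<and>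
     (\<forall>x\<in>carrier G. \<forall>y\<in>carrier G. f (x \<otimes> y) \<le> f x + f y) \<and>
     (\<forall>n. \<forall>x\<in>V n. f x \<le> (1/2)^Suc n) \<and>
     (\<forall>n. \<forall>x\<in>carrier G. f x < (1/2)^Suc n \<longrightarrow> x \<in> V n)"

lemma adapted_seminormD:
  assumes "adapted_seminorm V f"
  shows "f \<one> = 0" "\<And>x. x \<in> carrier G \<Longrightarrow> 0 \<le> f x"
    "\<And>x. x \<in> carrier G \<Longrightarrow> f (inv x) = f x"
    "\<And>x y. \<lbrakk>x \<in> carrier G; y \<in> carrier G\<rbrakk> \<Longrightarrow> f (x \<otimes> y) \<le> f x + f y"
    "\<And>n x. x \<in> V n \<Longrightarrow> f x \<le> (1/2)^Suc n"
    "\<And>n x. \<lbrakk>x \<in> carrier G; f x < (1/2)^Suc n\<rbrakk> \<Longrightarrow> x \<in> V n"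
  using assms unfolding adapted_seminorm_def by blast+

text \<open>The infimum of word weights works: concatenation gives subadditivity, reversal gives
  symmetry, one-letter words bound \<open>f\<close> from above on \<open>V n\<close>, and the chain
  lemma shows that small values force membership in \<open>V n\<close>.\<close>

lemma cube_sequence_seminorm:
  assumes V: "cube_sequence V"
  shows "\<exists>f. adapted_seminorm V f"
proof -
  \<comment> \<open>Prepending the carrier as letter 0 puts every group element into a one-letter
    word, so the infimum is not taken over an empty set.\<close>
  define W where "W = case_nat (carrier G) V"
  have W: "\<And>n. \<one> \<in> W n" "\<And>n. W n \<subseteq> carrier G" "\<And>n x. x \<in> W n \<Longrightarrow> inv x \<in> W n"
    using V openin_subset_carrier unfolding W_def cube_sequence_def symmetric_nhd_def
    by (auto split: nat.split)
  have cube: "x \<otimes> y \<otimes> z \<in> W n" if "x \<in> W (Suc n)" "y \<in> W (Suc n)" "z \<in> W (Suc n)" for n x y z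
  proof (cases n)
    case 0
    have "x \<in> carrier G" "y \<in> carrier G" "z \<in> carrier G"
      using that W(2) by blast+
    then show ?thesis using 0 by (simp add: W_def)
  next
    case (Suc m)
    then show ?thesis using that V by (simp add: W_def cube_sequence_def)
  qed
  define s :: "nat list \<Rightarrow> real" where "s ns = (\<Sum>n\<leftarrow>ns. (1/2)^n)" for ns
  have s0: "0 \<le> s ns" for ns
    unfolding s_def by (rule sum_list_nonneg) auto
  define C where "C x = {s ns | ns. x \<in> word_set W ns}" for x
  define f where "f x = Inf (C x)" for x
  have bdd: "bdd_below (C x)" for x
    using s0 by (auto simp: C_def intro!: bdd_belowI[of _ 0])
  have le: "f x \<le> s ns" if "x \<in> word_set W ns" for x ns
    unfolding f_def by (rule cInf_lower[OF _ bdd]) (use that in \<open>auto simp: C_def\<close>)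
  have ne: "C x \<noteq> {}" if "x \<in> carrier G" for x
  proof -
    have "x \<in> word_set W [0]"
      using that by (force simp: set_mult_def W_def)
    then show ?thesis unfolding C_def by blast
  qed
  have lt: "\<exists>ns. x \<in> word_set W ns \<and> s ns < r" if "x \<in> carrier G" "f x < r" for x r
    using cInf_lessD[OF ne[OF that(1)]] that(2) unfolding f_def C_def by blast
  have nonneg: "0 \<le> f x" if "x \<in> carrier G" for x
    unfolding f_def by (rule cInf_greatest[OF ne[OF that]]) (use s0 in \<open>auto simp: C_def\<close>)
  have "adapted_seminorm V f"
    unfolding adapted_seminorm_def
  proof (intro conjI ballI allI impI)
    have "f \<one> \<le> s []" by (rule le) simp
    then show "f \<one> = 0" using nonneg[of \<one>] by (simp add: s_def)
    show "0 \<le> f x" if "x \<in> carrier G" for x by (rule nonneg[OF that])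
    have inv_le: "f (inv x) \<le> f x" if "x \<in> carrier G" for x
      unfolding f_def[of x]
    proof (rule cInf_greatest[OF ne[OF that]])
      fix r assume "r \<in> C x"
      then obtain ns where ns: "r = s ns" "x \<in> word_set W ns" by (auto simp: C_def)
      have "s (rev ns) = s ns" by (simp add: s_def rev_map[symmetric])
      then show "f (inv x) \<le> r"
        using le[OF word_set_inv[OF W(2,3) ns(2)]] ns by simp
    qed
    show "f (inv x) = f x" if "x \<in> carrier G" for x
      using inv_le[OF that] inv_le[of "inv x"] that by simp
    show "f (x \<otimes> y) \<le> f x + f y" if xy: "x \<in> carrier G" "y \<in> carrier G" for x y
    \<comment> \<open>The infima need not be attained, so words within \<open>e/2\<close> of them
      are concatenated.\<close>
    proof (rule field_le_epsilon)
      fix e :: real assume "0 < e"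
      then obtain ms ns where "x \<in> word_set W ms" "s ms < f x + e/2" "y \<in> word_set W ns" "s ns < f y + e/2"
        using lt[OF xy(1), of "f x + e/2"] lt[OF xy(2), of "f y + e/2"] by auto
      moreover from this have "f (x \<otimes> y) \<le> s (ms @ ns)"
        by (intro le) (auto simp: word_set_append(2)[OF W(2)] set_mult_def)
      ultimately show "f (x \<otimes> y) \<le> f x + f y + e"
        by (simp add: s_def)
    qed
    show "f x \<le> (1/2)^Suc n" if "x \<in> V n" for n x
    proof -
      have "x \<in> word_set W [Suc n]"
        using that W(2)[of "Suc n"] by (force simp: set_mult_def W_def)
      from le[OF this] show ?thesis by (simp add: s_def)
    qed
    show "x \<in> V n" if "x \<in> carrier G" "f x < (1/2)^Suc n" for n x
    proof -
      obtain ns where ns: "x \<in> word_set W ns" "s ns < (1/2)^Suc n"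
        using lt[OF \<open>x \<in> carrier G\<close> \<open>f x < _\<close>] by blast
      have "word_set W ns \<subseteq> W (Suc n)"
        by (rule word_set_subset[OF W(1,2) cube]) (use ns(2) in \<open>simp_all add: s_def\<close>)
      then show ?thesis using ns(1) by (auto simp: W_def)
    qed
  qed
  then show ?thesis by blast
qed

section \<open>Complete regularity and metrizability of topological groups\<close>

text \<open>Telescoping through \<open>b\<close> turns subadditivity of a seminorm \<open>f\<close>
  into the triangle inequality for \<open>f (inv x \<otimes> y)\<close>.\<close>

lemma inv_mult_split:
  assumes "a \<in> carrier G" "b \<in> carrier G" "c \<in> carrier G"
  shows "inv a \<otimes> c = (inv a \<otimes> b) \<otimes> (inv b \<otimes> c)"
proof -
  have "b \<otimes> (inv b \<otimes> c) = c" using assms by (simp add: m_assoc[symmetric])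
  then show ?thesis using assms by (simp add: m_assoc)
qed

lemma cube_sequenceD:
  assumes "cube_sequence V"
  shows "openin T (V n)" "\<one> \<in> V n" "V n \<subseteq> carrier G" "x \<in> V n \<Longrightarrow> inv x \<in> V n"
    "\<lbrakk>x \<in> V (Suc n); y \<in> V (Suc n); z \<in> V (Suc n)\<rbrakk> \<Longrightarrow> x \<otimes> y \<otimes> z \<in> V n"
  using assms openin_subset_carrier unfolding cube_sequence_def symmetric_nhd_def by blast+

lemma cube_sequence_mult:
  assumes V: "cube_sequence V" and "x \<in> V (Suc n)" "y \<in> V (Suc n)"
  shows "x \<otimes> y \<in> V n"
  using cube_sequenceD(5)[OF V assms(2,3) cube_sequenceD(2)[OF V]] cube_sequenceD(3)[OF V] assms(2,3)
  by (metis m_closed r_one subset_iff)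

lemma cube_sequence_antimono:
  assumes V: "cube_sequence V" and "m \<le> n"
  shows "V n \<subseteq> V m"
proof (rule lift_Suc_antimono_le[OF _ assms(2)])
  show "V (Suc n) \<subseteq> V n" for n
    using cube_sequence_mult[OF V _ cube_sequenceD(2)[OF V]] cube_sequenceD(3)[OF V]
    by (metis r_one subset_iff)
qed

lemma symmetric_nhd_exists:
  assumes "openin T U" "\<one> \<in> U"
  shows "\<exists>V. symmetric_nhd V \<and> V \<subseteq> U"
  by (rule cube_nhd_exists[OF assms]) blast

lemma left_translate_nhd:
  assumes "openin T U" "\<one> \<in> U" "a \<in> carrier G"
  shows "openin T {y \<in> carrier G. inv a \<otimes> y \<in> U}" "a \<in> {y \<in> carrier G. inv a \<otimes> y \<in> U}"
  using openin_left_preimage[OF assms(1) inv_closed[OF assms(3)]] assms(2,3) by simp_all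

text \<open>With \<open>x\<close> translated to the identity, take a seminorm \<open>f\<close>
  adapted to neighbourhoods inside the translated complement of \<open>S\<close>. The function
  \<open>f (inv x \<otimes> y)\<close> of \<open>y\<close> vanishes at \<open>x\<close> and is at
  least \<open>1/2\<close> on \<open>S\<close>.\<close>

theorem completely_regular_space: "completely_regular_space T"
  unfolding completely_regular_space_def
proof (intro allI impI)
  fix S x assume S: "closedin T S \<and> x \<in> topspace T - S"
  then have x: "x \<in> carrier G" "openin T (topspace T - S)"
    by (auto simp: topspace_eq_carrier closedin_def)
  define U where "U = {y \<in> carrier G. x \<otimes> y \<in> topspace T - S}"
  have U: "openin T U" "\<one> \<in> U"
    using openin_left_preimage[OF x(2,1)] S x(1) by (auto simp: U_def)
  obtain V where V: "cube_sequence V" "\<And>n. V n \<subseteq> U"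
    by (rule cube_sequence_exists[of "\<lambda>_. True" "\<lambda>_. U"]) (use U symmetric_nhd_exists in auto)
  obtain f where "adapted_seminorm V f"
    using cube_sequence_seminorm[OF V(1)] by blast
  note f = adapted_seminormD[OF this]
  define g where "g y = f (inv x \<otimes> y)" for y
  have "\<exists>W. openin T W \<and> a \<in> W \<and> (\<forall>y\<in>W. g y \<in> Met_TC.mball (g a) e)"
    if "a \<in> topspace T" "0 < e" for a e
  proof -
    have a: "a \<in> carrier G" using that by (simp add: topspace_eq_carrier)
    obtain n where n: "(1/2::real)^Suc n < e"
      using real_arch_pow_inv[of "2 * e" "1/2"] \<open>0 < e\<close> by (auto simp: mult.commute)
    let ?W = "{y \<in> carrier G. inv a \<otimes> y \<in> V n}"
    have "dist (g a) (g y) < e" if "y \<in> ?W" for y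
    proof -
      have y: "y \<in> carrier G" "inv a \<otimes> y \<in> V n" using that by auto
      have less: "f (inv a \<otimes> y) < e"
        using f(5)[OF y(2)] n by linarith
      have "inv x \<otimes> y = (inv x \<otimes> a) \<otimes> (inv a \<otimes> y)"
        using inv_mult_split[OF x(1) a y(1)] .
      then have "g y \<le> g a + f (inv a \<otimes> y)"
        using f(4)[of "inv x \<otimes> a" "inv a \<otimes> y"] x(1) a y(1) by (simp add: g_def)
      \<comment> \<open>Exchanging \<open>a\<close> and \<open>y\<close> gives the opposite bound,
        since \<open>f\<close> is invariant under inversion; together they bound the distance of
        \<open>g a\<close> and \<open>g y\<close> by \<open>f (inv a \<otimes> y)\<close>.\<close>
      moreover have "inv x \<otimes> a = (inv x \<otimes> y) \<otimes> inv (inv a \<otimes> y)"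
        using inv_mult_split[OF x(1) y(1) a] a y(1) by (simp add: inv_mult_group)
      then have "g a \<le> g y + f (inv a \<otimes> y)"
        using f(4)[of "inv x \<otimes> y" "inv (inv a \<otimes> y)"] f(3)[of "inv a \<otimes> y"] x(1) a y(1)
        by (simp add: g_def)
      ultimately show ?thesis using less by (simp add: dist_real_def)
    qed
    then show "\<exists>W. openin T W \<and> a \<in> W \<and> (\<forall>y\<in>W. g y \<in> Met_TC.mball (g a) e)"
      using left_translate_nhd[OF cube_sequenceD(1,2)[OF V(1)] a, of n] 
      by (intro exI[of _ ?W]) auto
  qed
  then have g: "continuous_map T euclideanreal g"
    using Met_TC.continuous_map_to_metric[of T g] by simp
  \<comment> \<open>A value of \<open>f\<close> below \<open>1/2\<close> forces membership in
    \<open>V 0\<close>, hence in \<open>U\<close>; doubling and truncating therefore gives exactly 1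
    on \<open>S\<close>.\<close>
  let ?h = "\<lambda>y. min 1 (2 * g y)"
  have "continuous_map T euclideanreal ?h"
    using g by (intro continuous_map_real_min continuous_map_real_mult) auto
  moreover have "0 \<le> g y" if "y \<in> topspace T" for y
    using f(2) x(1) that by (simp add: g_def topspace_eq_carrier)
  ultimately have "continuous_map T (top_of_set {0..1}) ?h"
    by (auto simp: continuous_map_in_subtopology)
  moreover have "?h x = 0" using x f(1) by (simp add: g_def)
  moreover have "?h y = 1" if "y \<in> S" for y
  proof (rule ccontr)
    assume "?h y \<noteq> 1"
    moreover have y: "y \<in> carrier G" using S that closedin_subset topspace_eq_carrier by blast
    ultimately have "inv x \<otimes> y \<in> V 0"
      using f(6)[of "inv x \<otimes> y" 0] x(1) by (auto simp: g_def min_def split: if_splits)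
    then have "x \<otimes> (inv x \<otimes> y) \<notin> S" using V(2) by (auto simp: U_def)
    then show False using that x(1) y by (simp add: m_assoc[symmetric])
  qed
  ultimately show "\<exists>f::'a\<Rightarrow>real. continuous_map T (top_of_set {0..1}) f \<and> f x = 0 \<and> f ` S \<subseteq> {1}"
    by (intro exI[of _ ?h]) auto
qed

text \<open>The metric is the left-invariant \<open>f (inv x \<otimes> y)\<close>, with
  \<open>f\<close> adapted to a cube sequence inside the given base. The base makes the topologies
  agree and, with the Hausdorff property, separates points.\<close>

theorem Birkhoff_Kakutani:
  assumes B: "\<And>n::nat. openin T (B n)" "\<And>n. \<one> \<in> B n"
    and base: "\<And>U. \<lbrakk>openin T U; \<one> \<in> U\<rbrakk> \<Longrightarrow> \<exists>n. B n \<subseteq> U"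
  shows "metrizable_space T"
proof -
  obtain V where V: "cube_sequence V" "\<And>n. V n \<subseteq> B n"
    by (rule cube_sequence_exists[of "\<lambda>_. True" B]) (use B symmetric_nhd_exists in auto)
  obtain f where "adapted_seminorm V f"
    using cube_sequence_seminorm[OF V(1)] by blast
  note f = adapted_seminormD[OF this]
  \<comment> \<open>The value 0 off the carrier keeps \<open>d\<close> nonnegative and symmetric on
    the whole type, as the locale of metric spaces demands.\<close>
  define d where "d x y = (if x \<in> carrier G \<and> y \<in> carrier G then f (inv x \<otimes> y) else 0)" for x y
  have V_base: "\<exists>n. V n \<subseteq> U" if "openin T U" "\<one> \<in> U" for U
    using base[OF that] V(2) by blast
  interpret Metric_space "carrier G" d
  proof
    show "0 \<le> d x y" for x y by (simp add: d_def f(2))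
    show "d x y = d y x" for x y
      using f(3)[of "inv x \<otimes> y"] by (auto simp: d_def inv_mult_group)
    show "d x z \<le> d x y + d y z" if "x \<in> carrier G" "y \<in> carrier G" "z \<in> carrier G" for x y z
    proof -
      have "inv x \<otimes> z = (inv x \<otimes> y) \<otimes> (inv y \<otimes> z)"
        using inv_mult_split[OF that] .
      then show ?thesis using f(4)[of "inv x \<otimes> y" "inv y \<otimes> z"] that by (simp add: d_def)
    qed
    show "(d x y = 0) = (x = y)" if "x \<in> carrier G" "y \<in> carrier G" for x y
    proof
      assume "d x y = 0"
      show "x = y"
      proof (rule ccontr)
        assume "x \<noteq> y"
        then have ne: "inv x \<otimes> y \<noteq> \<one>"
          using that by (metis inv_equality inv_inv inv_closed)
        moreover have "inv x \<otimes> y \<in> carrier G" using that by simp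
        ultimately obtain U W where "openin T U" "openin T W" "\<one> \<in> U" "inv x \<otimes> y \<in> W" "disjnt U W"
          using Hausdorff[unfolded Hausdorff_space_def topspace_eq_carrier, rule_format, of \<one> "inv x \<otimes> y"]
          by auto
        then obtain n where "inv x \<otimes> y \<notin> V n"
          using V_base[of U] by (auto simp: disjnt_iff)
        then show False
          using f(6)[of "inv x \<otimes> y" n] \<open>d x y = 0\<close> that by (simp add: d_def)
      qed
    qed (use f(1) that in \<open>simp add: d_def\<close>)
  qed
  have "openin T U \<longleftrightarrow> openin mtopology U" for U
  proof
    assume U: "openin T U"
    show "openin mtopology U"
      unfolding openin_mtopology
    proof (intro conjI allI impI)
      show "U \<subseteq> carrier G" by (rule openin_subset_carrier[OF U])
      fix x assume x: "x \<in> U"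
      then have xG: "x \<in> carrier G" using openin_subset_carrier[OF U] by blast
      obtain n where n: "V n \<subseteq> {y \<in> carrier G. x \<otimes> y \<in> U}"
        using V_base[OF openin_left_preimage[OF U xG]] x xG by auto
      have "mball x ((1/2)^Suc n) \<subseteq> U"
      proof
        fix y assume y: "y \<in> mball x ((1/2)^Suc n)"
        then have "inv x \<otimes> y \<in> V n" using f(6)[of "inv x \<otimes> y" n] xG by (auto simp: d_def)
        then have "x \<otimes> (inv x \<otimes> y) \<in> U" using n by blast
        then show "y \<in> U" using xG y by (simp add: m_assoc[symmetric])
      qed
      then show "\<exists>r>0. mball x r \<subseteq> U" by (meson half_gt_zero zero_less_one zero_less_power)
    qed
  next
    assume U: "openin mtopology U"
    show "openin T U"
    proof (subst openin_subopen, safe)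
      fix x assume x: "x \<in> U"
      obtain r where r: "r > 0" "mball x r \<subseteq> U" using U x unfolding openin_mtopology by blast
      have xG: "x \<in> carrier G" using U x unfolding openin_mtopology by blast
      obtain n where n: "(1/2::real)^Suc n < r"
        using real_arch_pow_inv[of "2 * r" "1/2"] \<open>0 < r\<close> by (auto simp: mult.commute)
      let ?W = "{y \<in> carrier G. inv x \<otimes> y \<in> V n}"
      have "?W \<subseteq> mball x r"
      proof
        fix y assume y: "y \<in> ?W"
        then have "f (inv x \<otimes> y) < r"
          using f(5)[of "inv x \<otimes> y" n] n by simp
        then show "y \<in> mball x r" using xG y by (simp add: d_def)
      qed
      then show "\<exists>W. openin T W \<and> x \<in> W \<and> W \<subseteq> U"
        using left_translate_nhd[OF cube_sequenceD(1,2)[OF V(1)] xG, of n] r(2) by blast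
    qed
  qed
  then have "T = mtopology" by (simp add: topology_eq)
  then show ?thesis using metrizable_space_mtopology by simp
qed

subsection \<open>Precompactness\<close>

lemma pseudocompact_cluster_point:
  fixes A :: "nat \<Rightarrow> 'a set"
  assumes "pseudocompact_space T" and A: "\<And>n. openin T (A n)" "\<And>n. A n \<noteq> {}"
  shows "\<exists>x\<in>carrier G. \<forall>W. openin T W \<longrightarrow> x \<in> W \<longrightarrow> infinite {n. A n \<inter> W \<noteq> {}}"
proof -
  obtain x where "x \<in> topspace T" "\<And>W. \<lbrakk>openin T W; x \<in> W\<rbrakk> \<Longrightarrow> infinite {n. A n \<inter> W \<noteq> {}}"
    using completely_regular_pseudocompact_cluster_point[OF completely_regular_space assms(1), of A] A by blast
  then show ?thesis by (auto simp: topspace_eq_carrier)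
qed

text \<open>Failing this, one can choose \<open>x n\<close> with
  \<open>inv (x m) \<otimes> x n \<notin> U\<close> for \<open>m < n\<close>. Small open sets around
  the \<open>x n\<close> have a cluster point, and two of them coming near it force their centres
  too close together.\<close>

theorem pseudocompact_imp_precompact:
  assumes pc: "pseudocompact_space T" and U: "openin T U" "\<one> \<in> U"
  shows "\<exists>F. finite F \<and> F \<subseteq> carrier G \<and> (\<forall>y\<in>carrier G. \<exists>x\<in>F. inv x \<otimes> y \<in> U)"
proof (rule ccontr)
  assume no: "\<not> ?thesis"
  obtain W where W: "symmetric_nhd W" "\<And>x y z. \<lbrakk>x \<in> W; y \<in> W; z \<in> W\<rbrakk> \<Longrightarrow> x \<otimes> y \<otimes> z \<in> U"
    using cube_nhd_exists[OF U] by metis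
  obtain V where V: "symmetric_nhd V" "V \<subseteq> W" "\<And>x y z. \<lbrakk>x \<in> V; y \<in> V; z \<in> V\<rbrakk> \<Longrightarrow> x \<otimes> y \<otimes> z \<in> W"
    using cube_nhd_exists[of W] W(1) symmetric_nhd_def by metis
  have VD: "openin T V" "\<one> \<in> V" "V \<subseteq> carrier G" "\<And>x. x \<in> V \<Longrightarrow> inv x \<in> V"
    using V(1) openin_subset_carrier by (auto simp: symmetric_nhd_def)
  have step: "\<exists>y\<in>carrier G. \<forall>x\<in>F. inv x \<otimes> y \<notin> U" if "finite F" "F \<subseteq> carrier G" for F
  proof (rule ccontr)
    assume "\<not> ?thesis"
    then have "\<forall>y\<in>carrier G. \<exists>x\<in>F. inv x \<otimes> y \<in> U" by auto
    then show False using no that by meson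
  qed
  have "\<exists>x. \<forall>n::nat. x n \<in> carrier G \<and> (\<forall>m<n. inv (x m) \<otimes> x n \<notin> U)"
  proof -
    \<comment> \<open>Each choice must avoid all earlier ones, so the dependent choice runs over
      lists that carry the whole history.\<close>
    have "\<exists>xs. \<forall>n::nat. (length (xs n) = n \<and> set (xs n) \<subseteq> carrier G) \<and>
        (\<exists>y\<in>carrier G. xs (Suc n) = xs n @ [y] \<and> (\<forall>x\<in>set (xs n). inv x \<otimes> y \<notin> U))"
    proof (rule dependent_nat_choice)
      fix xs :: "'a list" and n assume *: "length xs = n \<and> set xs \<subseteq> carrier G"
      then obtain y where "y \<in> carrier G" "\<forall>x\<in>set xs. inv x \<otimes> y \<notin> U"
        using step[of "set xs"] by auto
      then show "\<exists>ys. (length ys = Suc n \<and> set ys \<subseteq> carrier G) \<and>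
          (\<exists>y\<in>carrier G. ys = xs @ [y] \<and> (\<forall>x\<in>set xs. inv x \<otimes> y \<notin> U))"
        using * by (intro exI[of _ "xs @ [y]"]) auto
    qed auto
    then obtain xs where xs: "\<And>n::nat. length (xs n) = n" "\<And>n. set (xs n) \<subseteq> carrier G"
      "\<And>n. \<exists>y\<in>carrier G. xs (Suc n) = xs n @ [y] \<and> (\<forall>x\<in>set (xs n). inv x \<otimes> y \<notin> U)"
      by blast
    define x where "x n = last (xs (Suc n))" for n
    have x: "x n \<in> carrier G" "xs (Suc n) = xs n @ [x n]" "\<forall>z\<in>set (xs n). inv z \<otimes> x n \<notin> U" for n
      using xs(3)[of n] by (auto simp: x_def)
    have "m < n \<Longrightarrow> x m \<in> set (xs n)" for m n
      by (induction n) (use x(2) less_Suc_eq in auto)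
    then show ?thesis using x by blast
  qed
  then obtain x where x: "\<And>n::nat. x n \<in> carrier G" "\<And>m n. m < n \<Longrightarrow> inv (x m) \<otimes> x n \<notin> U"
    by blast
  let ?A = "\<lambda>n. {y \<in> carrier G. inv (x n) \<otimes> y \<in> V}"
  have A: "openin T (?A n)" "?A n \<noteq> {}" for n
    using left_translate_nhd[OF VD(1,2) x(1)[of n]] by blast+
  obtain g where g: "g \<in> carrier G" "\<And>W. \<lbrakk>openin T W; g \<in> W\<rbrakk> \<Longrightarrow> infinite {n. ?A n \<inter> W \<noteq> {}}"
    using pseudocompact_cluster_point[OF pc, of ?A, OF A] by auto
  let ?I = "{n. ?A n \<inter> {y \<in> carrier G. inv g \<otimes> y \<in> V} \<noteq> {}}"
  have "infinite ?I"
    by (rule g(2)[OF left_translate_nhd[OF VD(1,2) g(1)]])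
  then obtain m where m: "m \<in> ?I" using infinite_imp_nonempty by blast
  obtain n where n: "n \<in> ?I" "m < n"
    using \<open>infinite ?I\<close> unfolding infinite_nat_iff_unbounded by blast
  \<comment> \<open>Where the translates of \<open>V\<close> around \<open>x k\<close> and
    \<open>g\<close> meet, \<open>inv (x k) \<otimes> g\<close> is an element of \<open>V\<close>
    times the inverse of another; a factor \<open>\<one>\<close> fits it to the cube
    condition.\<close>
  have gW: "inv (x k) \<otimes> g \<in> W" if k: "k \<in> ?I" for k
  proof -
    obtain y where y: "y \<in> carrier G" "inv (x k) \<otimes> y \<in> V" "inv g \<otimes> y \<in> V"
      using k by blast
    have "inv (inv g \<otimes> y) = inv y \<otimes> g" using y(1) g(1) by (simp add: inv_mult_group)
    then have "inv (x k) \<otimes> g = (inv (x k) \<otimes> y) \<otimes> inv (inv g \<otimes> y) \<otimes> \<one>"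
      using inv_mult_split[OF x(1)[of k] y(1) g(1)] x(1)[of k] y(1) g(1) by simp
    then show ?thesis using V(3)[OF y(2) VD(4)[OF y(3)] VD(2)] by simp
  qed
  have "inv (inv (x n) \<otimes> g) \<in> W"
    using W(1) gW[OF n(1)] by (auto simp: symmetric_nhd_def)
  moreover have "inv (inv (x n) \<otimes> g) = inv g \<otimes> x n"
    using x(1)[of n] g(1) by (simp add: inv_mult_group)
  ultimately have "(inv (x m) \<otimes> g) \<otimes> (inv g \<otimes> x n) \<otimes> \<one> \<in> U"
    using W(1,2) gW[OF m] by (auto simp: symmetric_nhd_def)
  then have "inv (x m) \<otimes> x n \<in> U"
    using inv_mult_split[OF x(1)[of m] g(1) x(1)[of n]] x(1) g(1) by simp
  then show False using x(2)[OF n(2)] by simp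
qed

section \<open>Conjugation-invariant neighbourhoods\<close>

definition conj_invariant :: "'a set \<Rightarrow> bool" where
  "conj_invariant V \<longleftrightarrow> (\<forall>g\<in>carrier G. \<forall>x\<in>V. inv g \<otimes> x \<otimes> g \<in> V)"

text \<open>Precompactness reduces conjugation to finitely many elements. If finitely many
  translates of \<open>V\<close> cover the group, a neighbourhood \<open>W\<close> whose conjugates
  by their centres lie in \<open>V\<close> has all its conjugates in \<open>U\<close>; the union of
  these is invariant.\<close>

lemma conj_invariant_nhd_exists:
  assumes pc: "pseudocompact_space T" and U: "openin T U" "\<one> \<in> U"
  shows "\<exists>V. symmetric_nhd V \<and> conj_invariant V \<and> V \<subseteq> U"
proof -
  obtain V where V: "symmetric_nhd V" "\<And>x y z. \<lbrakk>x \<in> V; y \<in> V; z \<in> V\<rbrakk> \<Longrightarrow> x \<otimes> y \<otimes> z \<in> U"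
    using cube_nhd_exists[OF U] by metis
  have VD: "openin T V" "\<one> \<in> V" "V \<subseteq> carrier G" "\<And>x. x \<in> V \<Longrightarrow> inv x \<in> V"
    using V(1) openin_subset_carrier by (auto simp: symmetric_nhd_def)
  obtain F where F: "finite F" "F \<subseteq> carrier G" "\<And>y. y \<in> carrier G \<Longrightarrow> \<exists>x\<in>F. inv x \<otimes> y \<in> V"
    using pseudocompact_imp_precompact[OF pc VD(1,2)] by blast
  define W where "W = carrier G \<inter> (\<Inter>x\<in>F. {y \<in> carrier G. inv x \<otimes> y \<otimes> x \<in> V})"
  have W: "openin T W" "\<one> \<in> W" "W \<subseteq> carrier G"
  proof -
    have "openin T (\<Inter>(insert (carrier G) ((\<lambda>x. {y \<in> carrier G. inv x \<otimes> y \<otimes> x \<in> V}) ` F)))"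
      using F(1,2) openin_translate_preimage[OF VD(1)] topspace_eq_carrier openin_topspace[of T]
      by (intro openin_Inter) auto
    then show "openin T W" by (simp add: W_def)
    show "\<one> \<in> W" "W \<subseteq> carrier G" using F(2) VD(2) by (auto simp: W_def)
  qed
  have WU: "inv g \<otimes> w \<otimes> g \<in> U" if gw: "g \<in> carrier G" "w \<in> W" for g w
  proof -
    obtain x where x: "x \<in> F" "inv x \<otimes> g \<in> V" using F(3)[OF gw(1)] by blast
    have car: "x \<in> carrier G" "w \<in> carrier G" using x F(2) that W(3) by auto
    have "inv (inv x \<otimes> g) \<in> V" using VD(4)[OF x(2)] .
    then have "inv g \<otimes> x \<in> V" using car that by (simp add: inv_mult_group)
    moreover have "inv x \<otimes> w \<otimes> x \<in> V" using that(2) x(1) by (auto simp: W_def)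
    \<comment> \<open>Conjugation by \<open>g\<close> is conjugation by the nearby centre
      \<open>x\<close>, corrected by \<open>inv x \<otimes> g\<close> and its inverse; all three
      factors lie in \<open>V\<close>.\<close>
    ultimately have "(inv g \<otimes> x) \<otimes> (inv x \<otimes> w \<otimes> x) \<otimes> (inv x \<otimes> g) \<in> U"
      using V(2) x(2) by blast
    moreover have "(inv g \<otimes> x) \<otimes> (inv x \<otimes> w \<otimes> x) \<otimes> (inv x \<otimes> g) = inv g \<otimes> w \<otimes> g"
    proof -
      have "x \<otimes> (inv x \<otimes> z) = z" if "z \<in> carrier G" for z
        using that car by (simp add: m_assoc[symmetric])
      then show ?thesis using car that by (simp add: m_assoc)
    qed
    ultimately show ?thesis by simp
  qed
  define C where "C = (\<Union>g\<in>carrier G. {y \<in> carrier G. g \<otimes> y \<otimes> inv g \<in> W})"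
  have C: "openin T C" "C \<subseteq> carrier G"
    unfolding C_def using openin_translate_preimage[OF W(1)] by auto
  have "C \<subseteq> U"
  proof
    fix y assume "y \<in> C"
    then obtain g where g: "g \<in> carrier G" "y \<in> carrier G" "g \<otimes> y \<otimes> inv g \<in> W"
      by (auto simp: C_def)
    have "inv g \<otimes> (g \<otimes> y \<otimes> inv g) \<otimes> g = y"
      using g(1,2) by (simp add: m_assoc) (simp add: m_assoc[symmetric])
    then show "y \<in> U" using WU[OF g(1,3)] by simp
  qed
  moreover have "\<one> \<in> C" using W(2) by (auto simp: C_def)
  moreover have inv_C: "conj_invariant C"
    unfolding conj_invariant_def
  proof (intro ballI)
    fix g x assume g: "g \<in> carrier G" and "x \<in> C"
    then obtain h where h: "h \<in> carrier G" "x \<in> carrier G" "h \<otimes> x \<otimes> inv h \<in> W"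
      by (auto simp: C_def)
    have "(h \<otimes> g) \<otimes> (inv g \<otimes> x \<otimes> g) \<otimes> inv (h \<otimes> g) = h \<otimes> x \<otimes> inv h"
    proof -
      have "g \<otimes> (inv g \<otimes> z) = z" if "z \<in> carrier G" for z
        using that g by (simp add: m_assoc[symmetric])
      then show ?thesis using g h by (simp add: m_assoc inv_mult_group)
    qed
    then show "inv g \<otimes> x \<otimes> g \<in> C"
      using g h by (auto simp: C_def intro!: bexI[of _ "h \<otimes> g"])
  qed
  \<comment> \<open>Symmetrizing keeps invariance because inversion commutes with
    conjugation.\<close>
  let ?C = "C \<inter> {x \<in> carrier G. inv x \<in> C}"
  have "conj_invariant ?C"
    unfolding conj_invariant_def
  proof (intro ballI)
    fix g x assume g: "g \<in> carrier G" and x: "x \<in> ?C"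
    have "inv (inv g \<otimes> x \<otimes> g) = inv g \<otimes> inv x \<otimes> g"
      using g x by (simp add: inv_mult_group m_assoc)
    then show "inv g \<otimes> x \<otimes> g \<in> ?C"
      using inv_C g x unfolding conj_invariant_def by auto
  qed
  moreover have "symmetric_nhd ?C"
    using C openin_inv_preimage[OF C(1)] \<open>\<one> \<in> C\<close> by (auto simp: symmetric_nhd_def)
  ultimately show ?thesis by blast
qed

subsection \<open>Quotient groups\<close>

lemma r_coset_eq_iff:
  assumes "N \<lhd> G" "x \<in> carrier G" "y \<in> carrier G"
  shows "N #> x = N #> y \<longleftrightarrow> x \<otimes> inv y \<in> N"
proof -
  interpret normal N G by fact
  show ?thesis
    using rcos_self[OF assms(2) subgroup_axioms] rcos_module[OF is_group assms(3,2)]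
      repr_independence[OF _ assms(3) subgroup_axioms, of x] by auto
qed

lemma topspace_quotient_group_topology:
  "topspace (quotient_group_topology G T N) = carrier (G Mod N)"
  using quotient_imp_surjective_map[OF quotient_map_quotient_group_topology[of N]]
  by (simp add: carrier_FactGroup topspace_eq_carrier)

text \<open>The saturation of \<open>U\<close> is the union of its translates by elements of
  \<open>N\<close>, hence open.\<close>

lemma open_map_r_coset:
  assumes N: "N \<lhd> G"
  shows "open_map T (quotient_group_topology G T N) (\<lambda>x. N #> x)"
  unfolding open_map_def openin_quotient_group_topology
proof (intro allI impI conjI)
  interpret normal N G by fact
  fix U assume U: "openin T U"
  then have UG: "U \<subseteq> carrier G" by (rule openin_subset_carrier)
  then show "(\<lambda>x. N #> x) ` U \<subseteq> carrier (G Mod N)"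
    by (auto simp: carrier_FactGroup)
  have "{x \<in> carrier G. N #> x \<in> (\<lambda>x. N #> x) ` U} = (\<Union>n\<in>N. {x \<in> carrier G. n \<otimes> x \<in> U})"
  proof (intro equalityI subsetI)
    fix x assume "x \<in> {x \<in> carrier G. N #> x \<in> (\<lambda>x. N #> x) ` U}"
    then obtain u where x: "x \<in> carrier G" and u: "u \<in> U" "N #> u = N #> x" by auto
    have "u \<otimes> inv x \<in> N" using r_coset_eq_iff[OF N] u x UG by auto
    moreover have "u \<otimes> inv x \<otimes> x = u" using u x UG by (auto simp: m_assoc)
    ultimately show "x \<in> (\<Union>n\<in>N. {x \<in> carrier G. n \<otimes> x \<in> U})"
      using u(1) x by (intro UN_I[of "u \<otimes> inv x"]) auto
  next
    fix x assume "x \<in> (\<Union>n\<in>N. {x \<in> carrier G. n \<otimes> x \<in> U})"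
    then obtain n where n: "n \<in> N" "x \<in> carrier G" "n \<otimes> x \<in> U" by auto
    have "n \<otimes> x \<otimes> inv x = n" using n subset by (auto simp: m_assoc)
    then have "N #> x = N #> (n \<otimes> x)" using r_coset_eq_iff[OF N, of "n \<otimes> x" x] n subset by auto
    then show "x \<in> {x \<in> carrier G. N #> x \<in> (\<lambda>x. N #> x) ` U}" using n by auto
  qed
  then show "openin T {x \<in> carrier G. N #> x \<in> (\<lambda>x. N #> x) ` U}"
    using openin_left_preimage[OF U] subset by auto
qed

lemma quotient_homomorphism_r_coset:
  assumes N: "N \<lhd> G"
  shows "quotient_homomorphism G T (G Mod N) (quotient_group_topology G T N) (\<lambda>x. N #> x)"
  using normal.r_coset_hom_Mod[OF N] open_map_r_coset[OF N]
    quotient_imp_continuous_map[OF quotient_map_quotient_group_topology[of N]]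
  by (simp add: quotient_homomorphism_def carrier_FactGroup)

text \<open>The coset map is open, so its square is again a quotient map and continuity of
  multiplication descends. Closedness of \<open>N\<close> makes
  \<open>x \<otimes> inv y \<notin> N\<close> an open condition on pairs, which gives the Hausdorff
  property.\<close>

lemma topological_group_quotient:
  assumes N: "N \<lhd> G" and cl: "closedin T N"
  shows "topological_group (G Mod N) (quotient_group_topology G T N)"
proof -
  let ?S = "quotient_group_topology G T N"
  let ?\<pi> = "\<lambda>x. N #> x"
  interpret normal N G by fact
  interpret Q: group "G Mod N" by (rule factorgroup_is_group)
  interpret \<pi>: group_hom G "G Mod N" ?\<pi>
    by unfold_locales (rule r_coset_hom_Mod)
  have cont: "continuous_map T ?S ?\<pi>" and opn: "open_map T ?S ?\<pi>"
    using quotient_homomorphism_r_coset[OF N] by (auto simp: quotient_homomorphism_def)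
  have top: "topspace ?S = ?\<pi> ` carrier G"
    by (simp add: topspace_quotient_group_topology carrier_FactGroup)
  let ?q = "\<lambda>(x, y). (?\<pi> x, ?\<pi> y)"
  have "continuous_map (prod_topology T T) (prod_topology ?S ?S) ?q"
    using continuous_map_pairedI[OF continuous_map_compose[OF continuous_map_fst cont]
        continuous_map_compose[OF continuous_map_snd cont]]
    by (simp add: o_def case_prod_beta')
  \<comment> \<open>Openness is what survives the product; a product of arbitrary quotient maps need
    not be a quotient map.\<close>
  moreover have "open_map (prod_topology T T) (prod_topology ?S ?S) ?q"
    unfolding open_map_def
  proof (intro allI impI)
    fix P assume P: "openin (prod_topology T T) P"
    show "openin (prod_topology ?S ?S) (?q ` P)"
      unfolding openin_prod_topology_alt
    proof (intro allI impI)
      fix X Y assume "(X, Y) \<in> ?q ` P"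
      then obtain x y where xy: "(x, y) \<in> P" "X = ?\<pi> x" "Y = ?\<pi> y" by auto
      then obtain A B where AB: "openin T A" "openin T B" "x \<in> A" "y \<in> B" "A \<times> B \<subseteq> P"
        using P unfolding openin_prod_topology_alt by meson
      have "openin ?S (?\<pi> ` A)" "openin ?S (?\<pi> ` B)" "?\<pi> ` A \<times> ?\<pi> ` B \<subseteq> ?q ` P"
        using AB opn by (force simp: open_map_def)+
      then show "\<exists>U V. openin ?S U \<and> openin ?S V \<and> X \<in> U \<and> Y \<in> V \<and> U \<times> V \<subseteq> ?q ` P"
        using AB(3,4) xy(2,3) by blast
    qed
  qed
  moreover have "?q ` topspace (prod_topology T T) = topspace (prod_topology ?S ?S)"
    by (auto simp: top topspace_eq_carrier)
  ultimately have q: "quotient_map (prod_topology T T) (prod_topology ?S ?S) ?q"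
    by (rule continuous_open_imp_quotient_map)
  show ?thesis
  proof (intro topological_group.intro topological_group_axioms.intro)
    show "group (G Mod N)" by (rule factorgroup_is_group)
    show "topspace ?S = carrier (G Mod N)" by (rule topspace_quotient_group_topology)
    show "continuous_map (prod_topology ?S ?S) ?S (\<lambda>(x, y). x \<otimes>\<^bsub>G Mod N\<^esub> y)"
    proof (rule continuous_compose_quotient_map[OF q])
      show "continuous_map (prod_topology T T) ?S ((\<lambda>(x, y). x \<otimes>\<^bsub>G Mod N\<^esub> y) \<circ> ?q)"
        by (rule continuous_map_eq[OF continuous_map_compose[OF continuous_mult cont]])
           (auto simp: topspace_eq_carrier)
    qed
    show "continuous_map ?S ?S (\<lambda>x. inv\<^bsub>G Mod N\<^esub> x)"
    proof (rule continuous_compose_quotient_map[OF quotient_map_quotient_group_topology])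
      show "continuous_map T ?S ((\<lambda>x. inv\<^bsub>G Mod N\<^esub> x) \<circ> ?\<pi>)"
        by (rule continuous_map_eq[OF continuous_map_compose[OF continuous_inv cont]])
           (simp add: topspace_eq_carrier)
    qed
    show "Hausdorff_space ?S"
      unfolding Hausdorff_space_def
    proof (intro allI impI)
      fix X Y assume "X \<in> topspace ?S \<and> Y \<in> topspace ?S \<and> X \<noteq> Y"
      then obtain x y where xy: "x \<in> carrier G" "y \<in> carrier G" "X = ?\<pi> x" "Y = ?\<pi> y"
        "x \<otimes> inv y \<notin> N"
        using r_coset_eq_iff[OF N] unfolding top by blast
      let ?P = "{p \<in> topspace (prod_topology T T). fst p \<otimes> inv (snd p) \<in> topspace T - N}"
      have "openin (prod_topology T T) ?P"
        by (rule openin_continuous_map_preimage[OF continuous_map_mult])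
           (use cl in \<open>auto intro: continuous_map_fst continuous_map_inv continuous_map_snd\<close>)
      moreover have "(x, y) \<in> ?P" using xy by (simp add: topspace_eq_carrier)
      ultimately obtain A B where AB: "openin T A" "openin T B" "x \<in> A" "y \<in> B" "A \<times> B \<subseteq> ?P"
        unfolding openin_prod_topology_alt by meson
      have "?\<pi> a \<noteq> ?\<pi> b" if "a \<in> A" "b \<in> B" for a b
      proof -
        have "(a, b) \<in> ?P" using that AB(5) by blast
        then show ?thesis using r_coset_eq_iff[OF N] by (auto simp: topspace_eq_carrier)
      qed
      then have "disjnt (?\<pi> ` A) (?\<pi> ` B)" by (auto simp: disjnt_iff)
      moreover have "openin ?S (?\<pi> ` A)" "openin ?S (?\<pi> ` B)"
        using AB opn by (auto simp: open_map_def)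
      ultimately show "\<exists>U V. openin ?S U \<and> openin ?S V \<and> X \<in> U \<and> Y \<in> V \<and> disjnt U V"
        using AB(3,4) xy(3,4) by blast
    qed
  qed
qed

section \<open>Quotients by the kernel of a cube sequence\<close>

text \<open>Normality comes from the invariance of each \<open>V n\<close>. For closedness, if
  \<open>x \<notin> V n\<close> then the translate of \<open>V (Suc n)\<close> around
  \<open>x\<close> misses the intersection: a common point would make \<open>x\<close> a product of
  two elements of \<open>V (Suc n)\<close>.\<close>

lemma cube_sequence_Inter_normal:
  assumes V: "cube_sequence V" and conj: "\<And>n. conj_invariant (V n)"
  shows "(\<Inter>n. V n) \<lhd> G" "closedin T (\<Inter>n. V n)"
proof -
  note VD = cube_sequenceD[OF V]
  let ?N = "\<Inter>n. V n"
  have "subgroup ?N G"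
  proof (rule subgroupI)
    show "?N \<subseteq> carrier G" "?N \<noteq> {}" using VD(2,3) by blast+
    show "inv a \<in> ?N" if "a \<in> ?N" for a using that VD(4) by blast
    show "a \<otimes> b \<in> ?N" if "a \<in> ?N" "b \<in> ?N" for a b
      using that cube_sequence_mult[OF V] by blast
  qed
  moreover have "x \<otimes> h \<otimes> inv x \<in> ?N" if "x \<in> carrier G" "h \<in> ?N" for x h
  proof (rule INT_I)
    fix n
    have "inv (inv x) \<otimes> h \<otimes> inv x \<in> V n"
      using conj[of n] that unfolding conj_invariant_def by blast
    then show "x \<otimes> h \<otimes> inv x \<in> V n" using that by simp
  qed
  ultimately show "?N \<lhd> G" by (simp add: normal_inv_iff)
  have "openin T (carrier G - ?N)"
  proof (subst openin_subopen, intro ballI)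
    fix x assume "x \<in> carrier G - ?N"
    then obtain n where x: "x \<in> carrier G" "x \<notin> V n" by blast
    let ?W = "{y \<in> carrier G. inv x \<otimes> y \<in> V (Suc n)}"
    have "y \<notin> ?N" if y: "y \<in> ?W" for y
    proof
      assume "y \<in> ?N"
      moreover have "inv (inv x \<otimes> y) \<in> V (Suc n)" using y VD(4) by blast
      ultimately have "y \<otimes> inv (inv x \<otimes> y) \<in> V n" using cube_sequence_mult[OF V] by blast
      moreover have "y \<otimes> inv (inv x \<otimes> y) = x"
        using x y by (simp add: inv_mult_group m_assoc[symmetric])
      ultimately show False using x(2) by simp
    qed
    then show "\<exists>W. openin T W \<and> x \<in> W \<and> W \<subseteq> carrier G - ?N"
      using left_translate_nhd[OF VD(1,2) x(1), of "Suc n"] by (intro exI[of _ ?W]) auto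
  qed
  then show "closedin T ?N"
    using VD(3) unfolding closedin_def topspace_eq_carrier by blast
qed

text \<open>If no \<open>V n\<close> is contained in \<open>U\<close>, points \<open>x n \<in> V n - U\<close> carry small neighbourhoods that can
  only cluster at points of the kernel, and the saturation of \<open>U\<close> excludes these too.\<close>

lemma cube_sequence_base_at_kernel:
  assumes pc: "pseudocompact_space T" and V: "cube_sequence V"
    and U: "openin T U" "\<one> \<in> U" and sat: "\<And>h u. \<lbrakk>h \<in> (\<Inter>n. V n); u \<in> U\<rbrakk> \<Longrightarrow> h \<otimes> u \<in> U"
  shows "\<exists>n. V n \<subseteq> U"
proof (rule ccontr)
  note VD = cube_sequenceD[OF V]
  assume "\<not> ?thesis"
  then have "\<forall>n. \<exists>x. x \<in> V n \<and> x \<notin> U" by blast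
  from choice[OF this] obtain x where x: "\<And>n. x n \<in> V n" "\<And>n. x n \<notin> U" by blast
  then have xG: "x n \<in> carrier G" for n using VD(3) by blast
  obtain W where W: "symmetric_nhd W" "\<And>x y z. \<lbrakk>x \<in> W; y \<in> W; z \<in> W\<rbrakk> \<Longrightarrow> x \<otimes> y \<otimes> z \<in> U"
    using cube_nhd_exists[OF U] by metis
  have WD: "openin T W" "\<one> \<in> W" "W \<subseteq> carrier G" "\<And>x. x \<in> W \<Longrightarrow> inv x \<in> W"
    using W(1) openin_subset_carrier by (auto simp: symmetric_nhd_def)
  \<comment> \<open>The factor \<open>W\<close> serves for cluster points inside the kernel, the
    factor \<open>V n\<close> for those outside.\<close>
  let ?A = "\<lambda>n. {y \<in> carrier G. inv (x n) \<otimes> y \<in> W \<inter> V n}"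
  have A: "openin T (?A n)" "?A n \<noteq> {}" for n
    using left_translate_nhd[of "W \<inter> V n" "x n"] WD(1,2) VD(1,2) xG by blast+
  obtain g where g: "g \<in> carrier G" "\<And>W. \<lbrakk>openin T W; g \<in> W\<rbrakk> \<Longrightarrow> infinite {n. ?A n \<inter> W \<noteq> {}}"
    using pseudocompact_cluster_point[OF pc, of ?A, OF A] by auto
  have cluster: "\<exists>n\<ge>m. \<exists>y\<in>carrier G. inv (x n) \<otimes> y \<in> W \<and> inv (x n) \<otimes> y \<in> V n \<and> inv g \<otimes> y \<in> Q"
    if "openin T Q" "\<one> \<in> Q" for Q and m :: nat
  proof -
    have "infinite {n. ?A n \<inter> {y \<in> carrier G. inv g \<otimes> y \<in> Q} \<noteq> {}}"
      by (rule g(2)[OF left_translate_nhd[OF that g(1)]])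
    then show ?thesis unfolding infinite_nat_iff_unbounded_le by blast
  qed
  have x_eq: "g \<otimes> ((inv g \<otimes> y) \<otimes> inv (inv (x n) \<otimes> y)) = x n"
    and g_eq: "x n \<otimes> (inv (x n) \<otimes> y) \<otimes> inv (inv g \<otimes> y) = g" if "y \<in> carrier G" for n y
  proof -
    have "inv a \<otimes> (a \<otimes> b) = b" "a \<otimes> (inv a \<otimes> b) = b" if "a \<in> carrier G" "b \<in> carrier G" for a b
      using that by (simp_all add: m_assoc[symmetric])
    then show "g \<otimes> ((inv g \<otimes> y) \<otimes> inv (inv (x n) \<otimes> y)) = x n"
      "x n \<otimes> (inv (x n) \<otimes> y) \<otimes> inv (inv g \<otimes> y) = g"
      using that xG[of n] g(1) by (simp_all add: inv_mult_group m_assoc)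
  qed
  show False
  proof (cases "g \<in> (\<Inter>n. V n)")
    case True
    obtain n y where y: "y \<in> carrier G" "inv (x n) \<otimes> y \<in> W" "inv g \<otimes> y \<in> W"
      using cluster[OF WD(1,2)] by blast
    have "(inv g \<otimes> y) \<otimes> inv (inv (x n) \<otimes> y) \<otimes> \<one> \<in> U"
      using W(2)[OF y(3) WD(4)[OF y(2)] WD(2)] .
    then have "(inv g \<otimes> y) \<otimes> inv (inv (x n) \<otimes> y) \<in> U"
      using y(1) xG[of n] g(1) by simp
    \<comment> \<open>Here \<open>x n\<close> is \<open>g\<close> times an element of
      \<open>U\<close> with \<open>g\<close> in the kernel, so saturation applies.\<close>
    then have "x n \<in> U" using sat[OF True] x_eq[OF y(1), of n] by force
    then show False using x(2) by blast
  next
    case False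
    then obtain m where m: "g \<notin> V m" by blast
    \<comment> \<open>With \<open>n \<ge> Suc m\<close>, the point \<open>x n\<close> and both
      correction factors lie in \<open>V (Suc m)\<close>; their product is \<open>g\<close>, which
      would then lie in \<open>V m\<close>.\<close>
    obtain n y where y: "n \<ge> Suc m" "y \<in> carrier G" "inv (x n) \<otimes> y \<in> V n" "inv g \<otimes> y \<in> V (Suc m)"
      using cluster[OF VD(1,2)] by blast
    have "V n \<subseteq> V (Suc m)" by (rule cube_sequence_antimono[OF V y(1)])
    then have "x n \<otimes> (inv (x n) \<otimes> y) \<otimes> inv (inv g \<otimes> y) \<in> V m"
      using VD(4)[OF y(4)] y(3) x(1) by (intro VD(5)) auto
    then show False using g_eq[OF y(2)] m by simp
  qed
qed

text \<open>Preimages of open sets are saturated, so the images of the \<open>V n\<close> form a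
  countable base at the identity of the quotient. Metrizability follows, and pseudocompactness,
  inherited by the quotient, upgrades it to compactness.\<close>

lemma compact_metrizable_quotient:
  assumes pc: "pseudocompact_space T" and V: "cube_sequence V" and conj: "\<And>n. conj_invariant (V n)"
  shows "compact_space (quotient_group_topology G T (\<Inter>n. V n))"
    and "metrizable_space (quotient_group_topology G T (\<Inter>n. V n))"
proof -
  let ?N = "\<Inter>n. V n"
  let ?S = "quotient_group_topology G T ?N"
  note VD = cube_sequenceD[OF V]
  note N = cube_sequence_Inter_normal[OF V conj]
  interpret normal ?N G by (rule N(1))
  interpret Q: topological_group "G Mod ?N" ?S by (rule topological_group_quotient[OF N])
  have hom: "continuous_map T ?S (\<lambda>x. ?N #> x)" "open_map T ?S (\<lambda>x. ?N #> x)"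
    "(\<lambda>x. ?N #> x) ` carrier G = carrier (G Mod ?N)"
    using quotient_homomorphism_r_coset[OF N(1)] by (auto simp: quotient_homomorphism_def)
  have one: "?N #> \<one> = \<one>\<^bsub>G Mod ?N\<^esub>"
    using subset by (simp add: coset_mult_one)
  show met: "metrizable_space ?S"
  proof (rule Q.Birkhoff_Kakutani[of "\<lambda>n. (\<lambda>x. ?N #> x) ` V n"])
    show "openin ?S ((\<lambda>x. ?N #> x) ` V n)" for n
      using hom(2) VD(1) by (auto simp: open_map_def)
    show "\<one>\<^bsub>G Mod ?N\<^esub> \<in> (\<lambda>x. ?N #> x) ` V n" for n
      using VD(2)[of n] one by (metis imageI)
    fix U assume U: "openin ?S U" "\<one>\<^bsub>G Mod ?N\<^esub> \<in> U"
    let ?O = "{x \<in> carrier G. ?N #> x \<in> U}"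
    have "\<exists>n. V n \<subseteq> ?O"
    proof (rule cube_sequence_base_at_kernel[OF pc V])
      show "openin T ?O" using U(1) by (simp add: openin_quotient_group_topology)
      show "\<one> \<in> ?O" using U(2) one by simp
      show "h \<otimes> u \<in> ?O" if h: "h \<in> ?N" and u: "u \<in> ?O" for h u
      proof -
        have G: "h \<in> carrier G" "u \<in> carrier G" using h u subset by auto
        have "h \<otimes> u \<otimes> inv u \<in> ?N" using G h by (simp add: m_assoc)
        then have "?N #> (h \<otimes> u) = ?N #> u" using r_coset_eq_iff[OF N(1)] G by blast
        then show ?thesis using u G by simp
      qed
    qed
    then show "\<exists>n. (\<lambda>x. ?N #> x) ` V n \<subseteq> U" by blast
  qed
  have "pseudocompact_space ?S"
    by (rule pseudocompact_space_continuous_map_image[OF pc hom(1)])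
      (simp add: hom(3) topspace_eq_carrier Q.topspace_eq_carrier)
  then show "compact_space ?S"
    using met by (rule pseudocompact_metrizable_imp_compact_space[rotated])
qed

text \<open>The set \<open>A\<close> records that \<open>U\<close> contains the saturation of a
  neighbourhood of the identity, which is what the initial topology requires. Infinitude comes from
  keeping a chosen injective sequence injective modulo \<open>N\<close>.\<close>

lemma infinite_compact_metrizable_quotient_exists:
  assumes pc: "pseudocompact_space T" and inf: "infinite (carrier G)" and U: "openin T U" "\<one> \<in> U"
  obtains N A where "N \<lhd> G" "closedin T N" "infinite (carrier (G Mod N))"
    "compact_space (quotient_group_topology G T N)" "metrizable_space (quotient_group_topology G T N)"
    "openin T A" "\<one> \<in> A" "\<And>n a. \<lbrakk>n \<in> N; a \<in> A\<rbrakk> \<Longrightarrow> n \<otimes> a \<in> U"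
proof -
  obtain g :: "nat \<Rightarrow> 'a" where g: "inj g" "range g \<subseteq> carrier G"
    using infinite_countable_subset[OF inf] by blast
  have gG: "g i \<in> carrier G" for i using g(2) by blast
  \<comment> \<open>Each \<open>D n\<close> is finite, hence closed, and misses
    \<open>\<one>\<close>, so \<open>U - D n\<close> is still an open neighbourhood; every pair of
    distinct indices is handled at some stage.\<close>
  define D where "D n = (\<lambda>(i, j). g i \<otimes> inv (g j)) ` {(i, j). i \<le> n \<and> j \<le> n \<and> i \<noteq> j}" for n
  have one_D: "\<one> \<notin> D n" for n
  proof
    assume "\<one> \<in> D n"
    then obtain i j where ij: "i \<noteq> j" "\<one> = g i \<otimes> inv (g j)" by (auto simp: D_def)
    then have "g i = g j" using gG by (metis inv_closed inv_equality inv_inv)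
    then show False using g(1) ij(1) by (simp add: inj_eq)
  qed
  have "finite {(i, j). i \<le> n \<and> j \<le> n \<and> i \<noteq> j}" for n :: nat
    by (rule finite_subset[of _ "{..n} \<times> {..n}"]) auto
  then have "closedin T (D n)" for n
    using gG Hausdorff by (intro closedin_Hausdorff_finite) (auto simp: D_def topspace_eq_carrier)
  then have B: "openin T (U - D n)" "\<one> \<in> U - D n" for n
    using U one_D by (auto intro: openin_diff)
  obtain V where V: "cube_sequence V" "\<And>n. conj_invariant (V n)" "\<And>n. V n \<subseteq> U - D n"
    by (rule cube_sequence_exists[of conj_invariant "\<lambda>n. U - D n", OF conj_invariant_nhd_exists[OF pc]])
      (use B in auto)
  let ?N = "\<Inter>n. V n"
  note N = cube_sequence_Inter_normal[OF V(1,2)]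
  show ?thesis
  \<comment> \<open>\<open>V 1\<close> works as \<open>A\<close> because the kernel lies in
    \<open>V 1\<close> and products of two elements of \<open>V 1\<close> lie in \<open>V 0\<close>,
    hence in \<open>U\<close>.\<close>
  proof (rule that[of ?N "V 1"])
    show "?N \<lhd> G" "closedin T ?N" by (fact N)+
    show "compact_space (quotient_group_topology G T ?N)" "metrizable_space (quotient_group_topology G T ?N)"
      by (fact compact_metrizable_quotient[OF pc V(1,2)])+
    show "openin T (V 1)" "\<one> \<in> V 1" by (fact cube_sequenceD[OF V(1)])+
    show "n \<otimes> a \<in> U" if "n \<in> ?N" "a \<in> V 1" for n a
      using cube_sequence_mult[OF V(1), of n 0 a] that V(3) by auto
    have "inj (\<lambda>i. ?N #> g i)"
    proof (rule injI, rule ccontr)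
      fix i j assume "?N #> g i = ?N #> g j" "i \<noteq> j"
      then have "g i \<otimes> inv (g j) \<in> V (max i j)"
        using r_coset_eq_iff[OF N(1)] gG by blast
      moreover have "g i \<otimes> inv (g j) \<in> D (max i j)"
        using \<open>i \<noteq> j\<close> by (force simp: D_def)
      ultimately show False using V(3) by blast
    qed
    then have "infinite (range (\<lambda>i. ?N #> g i))"
      using finite_imageD by blast
    moreover have "range (\<lambda>i. ?N #> g i) \<subseteq> carrier (G Mod ?N)"
      using gG by (auto simp: carrier_FactGroup)
    ultimately show "infinite (carrier (G Mod ?N))"
      using finite_subset by blast
  qed
qed

end

section \<open>The initial topology and the infinite separable quotient\<close>

theorem theorem3p5:
  fixes G :: "('a, 'm) monoid_scheme" and T :: "'a topology"
  assumes "topological_group G T" and "infinite (carrier G)" and "pseudocompact_space T"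
  shows "initial_wrt T (infinite_compact_metrizable_quotients G T) \<and>
    (\<exists>N. N \<lhd> G \<and> closedin T N \<and> infinite (carrier (G Mod N)) \<and>
         separable_space (quotient_group_topology G T N) \<and>
         compact_space (quotient_group_topology G T N) \<and>
         metrizable_space (quotient_group_topology G T N))"
proof
  interpret topological_group G T by fact
  note quot = infinite_compact_metrizable_quotient_exists[OF assms(3,2)]
  show "initial_wrt T (infinite_compact_metrizable_quotients G T)"
    unfolding initial_wrt_def
  proof (intro conjI allI impI)
    show "\<forall>(S, f)\<in>infinite_compact_metrizable_quotients G T. continuous_map T S f"
      by (auto simp: infinite_compact_metrizable_quotients_def quotient_homomorphism_def)
    fix Y U
    assume Y: "topspace Y = topspace T \<and>
        (\<forall>(S, f)\<in>infinite_compact_metrizable_quotients G T. continuous_map Y S f)"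
      and U: "openin T U"
    show "openin Y U"
    proof (subst openin_subopen, safe)
      fix x assume xU: "x \<in> U"
      then have x: "x \<in> carrier G" using openin_subset_carrier[OF U] by blast
      \<comment> \<open>The set \<open>U\<close> is moved to the identity by a right translation,
        which respects the right cosets of \<open>N\<close>.\<close>
      obtain N A where N: "N \<lhd> G" "closedin T N" "infinite (carrier (G Mod N))"
          "compact_space (quotient_group_topology G T N)" "metrizable_space (quotient_group_topology G T N)"
        and A: "openin T A" "\<one>\<^bsub>G\<^esub> \<in> A" "\<And>n a. \<lbrakk>n \<in> N; a \<in> A\<rbrakk> \<Longrightarrow> n \<otimes>\<^bsub>G\<^esub> a \<in> {y \<in> carrier G. y \<otimes>\<^bsub>G\<^esub> x \<in> U}"
        by (rule quot[OF openin_right_preimage[OF U x]]) (use x xU in auto)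
      let ?S = "quotient_group_topology G T N"
      let ?\<pi> = "\<lambda>y. N #>\<^bsub>G\<^esub> y"
      have qh: "quotient_homomorphism G T (G Mod N) ?S ?\<pi>"
        by (rule quotient_homomorphism_r_coset[OF N(1)])
      then have "(?S, ?\<pi>) \<in> infinite_compact_metrizable_quotients G T"
        unfolding infinite_compact_metrizable_quotients_def
        using topological_group_quotient[OF N(1,2)] N(3-5) by blast
      then have cont: "continuous_map Y ?S ?\<pi>" using Y by blast
      \<comment> \<open>This is the image of the right translate of \<open>A\<close> by
        \<open>x\<close>; its preimage consists of products from \<open>N\<close>, \<open>A\<close>
        and \<open>x\<close>, all of which lie in \<open>U\<close>.\<close>
      let ?W = "?\<pi> ` {y \<in> carrier G. y \<otimes>\<^bsub>G\<^esub> inv\<^bsub>G\<^esub> x \<in> A}"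
      have "openin ?S ?W"
        using qh openin_right_preimage[OF A(1) inv_closed[OF x]]
        by (simp add: quotient_homomorphism_def open_map_def)
      then have "openin Y {y \<in> topspace Y. ?\<pi> y \<in> ?W}"
        by (rule openin_continuous_map_preimage[OF cont])
      moreover have "x \<in> {y \<in> topspace Y. ?\<pi> y \<in> ?W}"
        using x A(2) Y by (auto simp: topspace_eq_carrier)
      moreover have "{y \<in> topspace Y. ?\<pi> y \<in> ?W} \<subseteq> U"
      proof
        fix y assume "y \<in> {y \<in> topspace Y. ?\<pi> y \<in> ?W}"
        then obtain z where y: "y \<in> carrier G" and z: "z \<in> carrier G" "z \<otimes>\<^bsub>G\<^esub> inv\<^bsub>G\<^esub> x \<in> A"
            and "?\<pi> y = ?\<pi> z"
          using Y by (auto simp: topspace_eq_carrier)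
        then have "y \<otimes>\<^bsub>G\<^esub> inv\<^bsub>G\<^esub> z \<in> N" using r_coset_eq_iff[OF N(1)] by blast
        from A(3)[OF this z(2)]
        have "(y \<otimes>\<^bsub>G\<^esub> inv\<^bsub>G\<^esub> z) \<otimes>\<^bsub>G\<^esub> (z \<otimes>\<^bsub>G\<^esub> inv\<^bsub>G\<^esub> x) \<otimes>\<^bsub>G\<^esub> x \<in> U" by simp
        moreover have "(y \<otimes>\<^bsub>G\<^esub> inv\<^bsub>G\<^esub> z) \<otimes>\<^bsub>G\<^esub> (z \<otimes>\<^bsub>G\<^esub> inv\<^bsub>G\<^esub> x) \<otimes>\<^bsub>G\<^esub> x = y"
        proof -
          have "inv\<^bsub>G\<^esub> z \<otimes>\<^bsub>G\<^esub> (z \<otimes>\<^bsub>G\<^esub> w) = w" if "w \<in> carrier G" for w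
            using that z(1) by (simp add: m_assoc[symmetric])
          then show ?thesis using x y z(1) by (simp add: m_assoc)
        qed
        ultimately show "y \<in> U" by simp
      qed
      ultimately show "\<exists>W. openin Y W \<and> x \<in> W \<and> W \<subseteq> U" by blast
    qed
  qed
  \<comment> \<open>Only existence matters here, so the whole group serves as the
    neighbourhood.\<close>
  obtain N A where N: "N \<lhd> G" "closedin T N" "infinite (carrier (G Mod N))"
      "compact_space (quotient_group_topology G T N)" "metrizable_space (quotient_group_topology G T N)"
    by (rule quot[of "carrier G"]) (use openin_topspace[of T] in \<open>auto simp: topspace_eq_carrier\<close>)
  moreover have "separable_space (quotient_group_topology G T N)"
    using N(4,5) by (rule compact_metrizable_imp_separable_space)
  ultimately show "\<exists>N. N \<lhd> G \<and> closedin T N \<and> infinite (carrier (G Mod N)) \<and>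
         separable_space (quotient_group_topology G T N) \<and>
         compact_space (quotient_group_topology G T N) \<and>
         metrizable_space (quotient_group_topology G T N)"
    by blast
qed

end
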